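(* Let $f_0(x)=\boldsymbol{\nu}_0 e^{T_0x}\boldsymbol{t}_0$, $x>0$, be the density of a phase-type distribution with parameters $T_0,\boldsymbol{\nu}_0,\boldsymbol{t}_0$ (where $\boldsymbol{t}_0=-T_0\boldsymbol{1}$), let $\theta>0$, let $G_0(\theta)=\int_0^\infty e^{-\theta x}f_0(x)\,dx$, and let $f_1(x)=\frac{1}{G_0(\theta)}e^{-\theta x}f_0(x)$ be the corresponding exponentially tilted density with tilt parameter $\theta$. Then for any decision boundaries $a<0<b$, the errors $\alpha_0$ and $\alpha_1$ of the Wald sequential probability ratio test of $f_0$ against $f_1$ are given by \begin{align*} &\alpha_0=1-\boldsymbol{\nu}_0 W_0(-a)W_0(-a+b+d)^{-1}\boldsymbol{1},\\ &\alpha_1=e^{-b}\boldsymbol{\nu}_0 W_0(-a)W_0(-a+b+d)^{-1}(\theta\mathbb{I}-T_0)^{-1}\boldsymbol{t}_0, \end{align*} where $d=-\log G_0(\theta)>0$, and the continuous matrix-valued function $W_0(x)$, $x\geq 0$, is identified by $$\int_0^\infty e^{-sx}W_0(x)\,dx=\left(T_0+\theta s\mathbb{I}+\boldsymbol{t}_0\boldsymbol{\nu}_0 e^{-ds}\right)^{-1}$$ for all sufficiently large $s$.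
   Context: Phase-type (PH) distributions: a PH distribution is the law of the life time (time to absorption) of a transient continuous-time Markov chain on finitely many states $1,\ldots,n$. It is parametrized by the $n\times n$ transition rate matrix $T$ of the chain restricted to the transient states (off-diagonal entries nonnegative, row sums nonpositive, all states transient), the row vector $\boldsymbol{\nu}$ giving the initial distribution on $\{1,\ldots,n\}$ (a probability vector), and the column vector of absorption rates $\boldsymbol{t}=-T\boldsymbol{1}$. Its density is $f(x)=\boldsymbol{\nu}e^{Tx}\boldsymbol{t}$. Here $\boldsymbol{1}$ is the column vector of ones and $\mathbb{I}$ is the $n\times n$ identity matrix. Wald's test: let $\zeta_1,\zeta_2,\ldots$ be i.i.d. with density $f$, where $f=f_0$ under hypothesis $H_0$ (probability measure $\mathbb{P}_0$) and $f=f_1$ under hypothesis $H_1$ (probability measure $\mathbb{P}_1$). Put $\Lambda_0=0$, $\Lambda_k=\sum_{i=1}^k\log\frac{f_0(\zeta_i)}{f_1(\zeta_i)}$, and for $a<0<b$ let $N=\inf\{k\ge 0:\Lambda_k\notin(a,b)\}$. At time $N$ the test accepts $H_0$ if $\Lambda_N\ge b$ and accepts $H_1$ if $\Lambda_N\le a$. The errors are $\alpha_0=\mathbb{P}_0(\text{reject }H_0)=\mathbb{P}_0(\Lambda_N\le a)$ and $\alpha_1=\mathbb{P}_1(\text{reject }H_1)=\mathbb{P}_1(\Lambda_N\ge b)$. The function $W_0$ is the (matrix-valued) scale function of a Markov additive process without positive jumps; it is known from the general theory that a continuous function with the given transform exists, is unique, and that $W_0(x)$ is non-singular for $x>0$.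 *)

theory Defs
  imports "HOL-Probability.Probability"
begin

text \<open>
  The algebra structure carried by \<^typ>\<open>real^'n^'n\<close> in the library is the componentwise one, so
  \<^const>\<open>exp\<close> is not available for matrices; the matrix exponential is its power series with respect
  to the matrix product.
\<close>

definition mat_pow :: "real^'n^'n \<Rightarrow> nat \<Rightarrow> real^'n^'n" where
  "mat_pow A k = ((**) A ^^ k) (mat 1)"

definition mat_exp :: "real^'n^'n \<Rightarrow> real^'n^'n" where
  "mat_exp A = (\<Sum>k. (1 / fact k) *\<^sub>R mat_pow A k)"

definition outer :: "real^'n \<Rightarrow> real^'n \<Rightarrow> real^'n^'n" where
  "outer u v = (\<chi> i j. u $ i * v $ j)"

text \<open>
  The entry \<open>i,j\<close> of \<open>mat_exp (x *\<^sub>R T)\<close> is the probability that the chain started in \<open>i\<close> is in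
  \<open>j\<close> at time \<open>x\<close>, not having been absorbed before. State \<open>i\<close> is transient iff the expected total time spent in it
  when starting from it, that is the integral of the entry \<open>i,i\<close> over time, is finite.
\<close>

definition transient_state :: "real^'n^'n \<Rightarrow> 'n \<Rightarrow> bool" where
  "transient_state T i \<longleftrightarrow> set_integrable lborel {0..} (\<lambda>x. mat_exp (x *\<^sub>R T) $ i $ i)"

definition phase_type :: "real^'n^'n \<Rightarrow> real^'n \<Rightarrow> bool" where
  "phase_type T \<nu> \<longleftrightarrow>
     (\<forall>i j. i \<noteq> j \<longrightarrow> T $ i $ j \<ge> 0) \<and>
     (\<forall>i. (\<Sum>j\<in>UNIV. T $ i $ j) \<le> 0) \<and>
     (\<forall>i. transient_state T i) \<and>
     (\<forall>i. \<nu> $ i \<ge> 0) \<and> (\<Sum>i\<in>UNIV. \<nu> $ i) = 1"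

text \<open>Here \<^term>\<open>1 :: real^'n\<close> is the vector all of whose components are one.\<close>

definition absorption_rates :: "real^'n^'n \<Rightarrow> real^'n" where
  "absorption_rates T = - (T *v 1)"

definition ph_density :: "real^'n^'n \<Rightarrow> real^'n \<Rightarrow> real \<Rightarrow> real" where
  "ph_density T \<nu> x =
     (if x > 0 then \<nu> \<bullet> (mat_exp (x *\<^sub>R T) *v absorption_rates T) else 0)"

definition laplace :: "(real \<Rightarrow> real) \<Rightarrow> real \<Rightarrow> real" where
  "laplace f \<theta> = (LINT x:{0<..}|lborel. exp (- (\<theta> * x)) * f x)"

definition tilted_density :: "(real \<Rightarrow> real) \<Rightarrow> real \<Rightarrow> real \<Rightarrow> real" where
  "tilted_density f \<theta> x = 1 / laplace f \<theta> * exp (- (\<theta> * x)) * f x"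

text \<open>Observations are indexed from 1; the value of the sequence at index 0 plays no role.\<close>

definition iid_density :: "'a measure \<Rightarrow> (nat \<Rightarrow> 'a \<Rightarrow> real) \<Rightarrow> (real \<Rightarrow> real) \<Rightarrow> bool" where
  "iid_density M \<zeta> f \<longleftrightarrow>
     prob_space M \<and>
     prob_space.indep_vars M (\<lambda>_. borel) \<zeta> {1..} \<and>
     (\<forall>i\<ge>1. distributed M lborel (\<zeta> i) (\<lambda>x. ennreal (f x)))"

definition log_lr ::
  "(real \<Rightarrow> real) \<Rightarrow> (real \<Rightarrow> real) \<Rightarrow> (nat \<Rightarrow> 'a \<Rightarrow> real) \<Rightarrow> nat \<Rightarrow> 'a \<Rightarrow> real" where
  "log_lr f0 f1 \<zeta> k \<omega> = (\<Sum>i=1..k. ln (f0 (\<zeta> i \<omega>) / f1 (\<zeta> i \<omega>)))"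

definition exit_index :: "real \<Rightarrow> real \<Rightarrow> (nat \<Rightarrow> 'a \<Rightarrow> real) \<Rightarrow> 'a \<Rightarrow> enat" where
  "exit_index a b L \<omega> = Inf {enat k |k. L k \<omega> \<notin> {a<..<b}}"

text \<open>
  Under \<open>M\<close>, the probability that the test stops after finitely many observations and then
  accepts \<open>H\<^sub>1\<close>, respectively \<open>H\<^sub>0\<close>.
\<close>

definition prob_accept1 ::
  "'a measure \<Rightarrow> (real \<Rightarrow> real) \<Rightarrow> (real \<Rightarrow> real) \<Rightarrow> (nat \<Rightarrow> 'a \<Rightarrow> real) \<Rightarrow> real \<Rightarrow> real \<Rightarrow> real" where
  "prob_accept1 M f0 f1 \<zeta> a b =
     measure M {\<omega> \<in> space M.
       \<exists>k. exit_index a b (log_lr f0 f1 \<zeta>) \<omega> = enat k \<and> log_lr f0 f1 \<zeta> k \<omega> \<le> a}"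

definition prob_accept0 ::
  "'a measure \<Rightarrow> (real \<Rightarrow> real) \<Rightarrow> (real \<Rightarrow> real) \<Rightarrow> (nat \<Rightarrow> 'a \<Rightarrow> real) \<Rightarrow> real \<Rightarrow> real \<Rightarrow> real" where
  "prob_accept0 M f0 f1 \<zeta> a b =
     measure M {\<omega> \<in> space M.
       \<exists>k. exit_index a b (log_lr f0 f1 \<zeta>) \<omega> = enat k \<and> log_lr f0 f1 \<zeta> k \<omega> \<ge> b}"

end

theory Submission imports Defs begin

text \<open>
  Tilting makes the log-likelihood ratio linear: \<open>ln (f\<^sub>0 x / f\<^sub>1 x) = \<theta> x - d\<close>, so the test statistic is a
  random walk with steps \<open>\<theta> \<zeta>\<^sub>i - d\<close>, and both errors are exit probabilities of this walk from \<open>(a, b)\<close>.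
  Think of each observation as a phase-type life time during which a level climbs at speed \<open>\<theta>\<close>, followed by
  a jump down by \<open>d\<close>. The walk leaves through \<open>b\<close> exactly when the climbing level reaches \<open>b + d\<close> before a
  jump takes it below \<open>a\<close>. Measured from \<open>a\<close>, the level starts at \<open>- a\<close> and has to reach \<open>L = b + d - a\<close>.

  The proof does not construct this level process. For a vector \<open>p\<close>, inverting the Laplace transform
  turns \<open>H x = W\<^sub>0 x p\<close> into the solution of the delay equation
  \<open>\<theta> H' x + T H x + (\<nu> \<bullet> H (x - d)) t = 0\<close> with \<open>H 0 = p / \<theta>\<close> and \<open>H = 0\<close> on the negative half-line
  (lemma \<open>scale_function_delay_solution\<close>; Laplace transforms determine continuous functions by the
  Weierstrass approximation theorem, \<open>laplace_transform_eq_0_imp_eq_0\<close>). Variation of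
  constants along \<open>exp (x T) H (y + \<theta> x)\<close> then yields
  \<open>H y = exp (R T) (H L) + (\<integral>x\<in>{0..R}. u (y + \<theta> x - d) exp (x T) t)\<close> with \<open>R = (L - y) / \<theta>\<close> and \<open>u z = \<nu> \<bullet> H z\<close>,
  and its product with \<open>\<nu>\<close> is the one-step equation of the walk: the first term collects the observations
  so long that the walk jumps over \<open>b\<close>, and the integral those after which it continues.

  Three consequences give the theorem. If \<open>H L = 0\<close>, the one-step equation is a strict contraction, because a life
  time exceeds every bound with positive probability; hence \<open>u\<close>, \<open>H\<close> and \<open>p\<close> vanish, and \<open>W\<^sub>0 L\<close> is
  invertible (\<open>delay_solution_zero_at_end\<close>). If \<open>H L = v\<close>, then \<open>u\<close>, suitably shifted and exponentially weighted, is
  harmonic for the walk stopped on leaving \<open>(a, b)\<close> (\<open>scale_function_harmonic\<close>). A bounded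
  harmonic function that is 1 above \<open>b\<close> and 0 below \<open>a\<close> is the probability of leaving through \<open>b\<close>, as the
  stopped walk is a bounded martingale under it and leaves almost surely (\<open>random_walk_exit_probability\<close>).

  Both hypotheses are handled at once by \<open>wald_test_acceptance_probabilities\<close>: observations have density
  \<open>exp (\<kappa> (d - \<theta> x)) f\<^sub>0 x\<close>, with \<open>\<kappa> = 0\<close> under \<open>H\<^sub>0\<close> and \<open>\<kappa> = 1\<close> under \<open>H\<^sub>1\<close>, and \<open>v\<close> solves \<open>(\<kappa> \<theta> - T) v = t\<close>. This gives
  \<open>v = 1\<close> in the first case and the resolvent applied to \<open>t\<close> in the second.
\<close>

section \<open>The matrix exponential\<close>

lemma bounded_bilinear_matrix_mult:
  "bounded_bilinear ((**) :: real^'n^'m \<Rightarrow> real^'k^'n \<Rightarrow> real^'k^'m)"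
  unfolding bilinear_conv_bounded_bilinear[symmetric] bilinear_def
  by (auto intro!: linearI simp: vec_eq_iff matrix_matrix_mult_def algebra_simps
      sum.distrib sum_distrib_left)

lemma bounded_bilinear_matrix_vector_mult:
  "bounded_bilinear ((*v) :: real^'n^'m \<Rightarrow> real^'n \<Rightarrow> real^'m)"
  unfolding bilinear_conv_bounded_bilinear[symmetric] bilinear_def
  by (auto intro!: linearI simp: matrix_vector_mult_add_rdistrib matrix_vector_right_distrib 
      scaleR_matrix_vector_assoc matrix_vector_mult_scaleR)

lemmas continuous_on_matrix_vector_mult =
  bounded_bilinear.continuous_on[OF bounded_bilinear_matrix_vector_mult]

lemma inner_axis_nested: "(A :: real^'n^'m) \<bullet> axis i (axis j 1) = A $ i $ j"
  by (simp add: inner_axis inner_axis')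

lemma has_vector_derivative_matrixI:
  fixes f :: "real \<Rightarrow> real^'n^'m"
  assumes "\<And>i j. ((\<lambda>x. f x $ i $ j) has_real_derivative D $ i $ j) (at x within S)"
  shows "(f has_vector_derivative D) (at x within S)"
proof -
  have "((\<lambda>x. f x \<bullet> B) has_derivative (\<lambda>h. h *\<^sub>R D \<bullet> B)) (at x within S)" if "B \<in> Basis" for B
  proof -
    from that obtain i j where B: "B = axis i (axis j 1)"
      by (auto simp: Basis_vec_def)
    show ?thesis
      using assms[of i j] unfolding B
      by (simp add: inner_axis_nested has_field_derivative_def mult_commute_abs)
  qed
  then show ?thesis
    unfolding has_vector_derivative_def by (subst has_derivative_componentwise_within) auto
qed

lemma mat_pow_0 [simp]: "mat_pow A 0 = mat 1"
  by (simp add: mat_pow_def)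

lemma mat_pow_Suc: "mat_pow A (Suc k) = A ** mat_pow A k"
  by (simp add: mat_pow_def)

lemma mat_pow_commute: "mat_pow A k ** A = A ** mat_pow A k"
  by (induction k) (simp_all add: mat_pow_Suc flip: matrix_mul_assoc)

lemma mat_pow_scaleR: "mat_pow (c *\<^sub>R A) k = c ^ k *\<^sub>R mat_pow (A :: real^'n^'n) k"
  by (induction k)
     (simp_all add: mat_pow_Suc bounded_bilinear.scaleR_left[OF bounded_bilinear_matrix_mult]
        bounded_bilinear.scaleR_right[OF bounded_bilinear_matrix_mult])

lemma mat_pow_entry_bound:
  fixes A :: "real^'n^'n"
  assumes "\<And>i j. \<bar>A $ i $ j\<bar> \<le> m"
  shows "\<bar>mat_pow A k $ i $ j\<bar> \<le> (real CARD('n) * m) ^ k"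
proof (induction k arbitrary: i j)
  case 0
  show ?case by (simp add: mat_def)
next
  case (Suc k)
  have m: "0 \<le> m"
    using assms[of i j] by linarith
  have "\<bar>mat_pow A (Suc k) $ i $ j\<bar> = \<bar>\<Sum>l\<in>UNIV. A $ i $ l * mat_pow A k $ l $ j\<bar>"
    by (simp add: mat_pow_Suc matrix_matrix_mult_def)
  also have "\<dots> \<le> (\<Sum>l\<in>UNIV. \<bar>A $ i $ l * mat_pow A k $ l $ j\<bar>)"
    by (rule sum_abs)
  also have "\<dots> \<le> (\<Sum>l\<in>(UNIV::'n set). m * (real CARD('n) * m) ^ k)"
    unfolding abs_mult using m by (intro sum_mono mult_mono assms Suc) auto
  finally show ?case by simp
qed

lemma summable_mat_exp_entry:
  fixes A :: "real^'n^'n"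
  shows "summable (\<lambda>k. mat_pow A k $ i $ j / fact k * x ^ k)"
proof (rule summable_comparison_test')
  define m where "m = Max (range (\<lambda>(i, j). \<bar>A $ i $ j\<bar>))"
  have m: "\<bar>A $ i $ j\<bar> \<le> m" for i j
    unfolding m_def by (rule Max_ge) (auto intro: image_eqI[of _ _ "(i, j)"])
  define C where "C = real CARD('n) * m * \<bar>x\<bar>"
  show "summable (\<lambda>k. inverse (fact k) * C ^ k)"
    by (rule summable_exp)
  show "norm (mat_pow A k $ i $ j / fact k * x ^ k) \<le> inverse (fact k) * C ^ k" if "k \<ge> 0" for k
    using mat_pow_entry_bound[OF m, of k i j]
    by (auto simp: C_def abs_mult power_mult_distrib divide_inverse power_abs mult_ac
        dest: mult_left_mono[of _ _ "\<bar>x\<bar> ^ k"])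
qed

text \<open>
  The exponential is handled entry by entry as an ordinary power series in \<open>x\<close>, so that the
  library's theory of real power series supplies the derivative.
\<close>

lemma mat_exp_entry_sums:
  fixes A :: "real^'n^'n"
  shows "(\<lambda>k. mat_pow A k $ i $ j / fact k * x ^ k) sums (mat_exp (x *\<^sub>R A) $ i $ j)"
proof -
  define E :: "real^'n^'n" where "E = (\<chi> i j. \<Sum>k. mat_pow A k $ i $ j / fact k * x ^ k)"
  have entry: "(\<lambda>k. mat_pow A k $ i $ j / fact k * x ^ k) sums E $ i $ j" for i j
    using summable_sums[OF summable_mat_exp_entry] by (simp add: E_def)
  have "(\<lambda>k. (1 / fact k) *\<^sub>R mat_pow (x *\<^sub>R A) k) sums E"
    unfolding sums_def
    using entry by (intro vec_tendstoI) (simp add: sums_def mat_pow_scaleR mult_ac)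
  then have "mat_exp (x *\<^sub>R A) = E"
    by (simp add: mat_exp_def sums_iff)
  then show ?thesis
    using entry by simp
qed

lemma mat_exp_0 [simp]: "mat_exp (0 :: real^'n^'n) = mat 1"
proof -
  have "mat_exp (0 *\<^sub>R (0 :: real^'n^'n)) $ i $ j = mat 1 $ i $ j" for i j
    using sums_unique2[OF mat_exp_entry_sums[of 0 i j 0] powser_sums_zero] by simp
  then show ?thesis
    by (simp add: vec_eq_iff)
qed

lemma matrix_mult_mat_exp_entry_sums:
  fixes A :: "real^'n^'n"
  shows "(\<lambda>k. (A ** mat_pow A k) $ i $ j / fact k * x ^ k) sums ((A ** mat_exp (x *\<^sub>R A)) $ i $ j)"
    and "(\<lambda>k. (mat_pow A k ** A) $ i $ j / fact k * x ^ k) sums ((mat_exp (x *\<^sub>R A) ** A) $ i $ j)"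
proof -
  have "(\<lambda>k. \<Sum>l\<in>UNIV. A $ i $ l * (mat_pow A k $ l $ j / fact k * x ^ k)) sums
      (\<Sum>l\<in>UNIV. A $ i $ l * mat_exp (x *\<^sub>R A) $ l $ j)"
    by (intro sums_sum sums_mult mat_exp_entry_sums)
  then show "(\<lambda>k. (A ** mat_pow A k) $ i $ j / fact k * x ^ k) sums ((A ** mat_exp (x *\<^sub>R A)) $ i $ j)"
    by (simp add: matrix_matrix_mult_def sum_distrib_right sum_divide_distrib mult.assoc)
  have "(\<lambda>k. \<Sum>l\<in>UNIV. (mat_pow A k $ i $ l / fact k * x ^ k) * A $ l $ j) sums
      (\<Sum>l\<in>UNIV. mat_exp (x *\<^sub>R A) $ i $ l * A $ l $ j)"
    by (intro sums_sum sums_mult2 mat_exp_entry_sums)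
  then show "(\<lambda>k. (mat_pow A k ** A) $ i $ j / fact k * x ^ k) sums ((mat_exp (x *\<^sub>R A) ** A) $ i $ j)"
    by (simp add: matrix_matrix_mult_def sum_distrib_right sum_distrib_left sum_divide_distrib mult_ac)
qed

lemma mat_exp_commute:
  fixes A :: "real^'n^'n"
  shows "mat_exp (x *\<^sub>R A) ** A = A ** mat_exp (x *\<^sub>R A)"
proof -
  have "(mat_exp (x *\<^sub>R A) ** A) $ i $ j = (A ** mat_exp (x *\<^sub>R A)) $ i $ j" for i j
    using matrix_mult_mat_exp_entry_sums[of A i j x] unfolding mat_pow_commute
    by (rule sums_unique2[rotated])
  then show ?thesis
    by (simp add: vec_eq_iff)
qed

lemma mat_exp_has_vector_derivative:
  fixes A :: "real^'n^'n"
  shows "((\<lambda>x. mat_exp (x *\<^sub>R A)) has_vector_derivative mat_exp (x *\<^sub>R A) ** A) (at x within S)"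
proof (rule has_vector_derivative_matrixI, rule has_field_derivative_at_within)
  fix i j
  define c where "c k = mat_pow A k $ i $ j / fact k" for k
  have suminf: "(\<Sum>k. c k * x ^ k) = mat_exp (x *\<^sub>R A) $ i $ j" for x
    using mat_exp_entry_sums[of A i j x] by (simp add: c_def sums_iff)
  have diffs: "diffs c k = (A ** mat_pow A k) $ i $ j / fact k" for k
    by (simp add: diffs_def c_def mat_pow_Suc divide_simps)
  have "((\<lambda>x. \<Sum>k. c k * x ^ k) has_real_derivative (\<Sum>k. diffs c k * x ^ k)) (at x)"
    by (rule termdiffs_strong_converges_everywhere) (unfold c_def, rule summable_mat_exp_entry)
  also have "(\<Sum>k. diffs c k * x ^ k) = (mat_exp (x *\<^sub>R A) ** A) $ i $ j"
    using matrix_mult_mat_exp_entry_sums(1)[of A i j x]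
    by (simp add: sums_iff mat_exp_commute diffs)
  finally show "((\<lambda>x. mat_exp (x *\<^sub>R A) $ i $ j) has_real_derivative (mat_exp (x *\<^sub>R A) ** A) $ i $ j) (at x)"
    by (simp add: suminf)
qed

lemma continuous_on_mat_exp [continuous_intros]:
  fixes A :: "real^'n^'n"
  assumes "continuous_on S g"
  shows "continuous_on S (\<lambda>x. mat_exp (g x *\<^sub>R A))"
proof -
  have "continuous_on UNIV (\<lambda>x. mat_exp (x *\<^sub>R A))"
    by (rule continuous_on_vector_derivative[OF mat_exp_has_vector_derivative])
  from continuous_on_compose2[OF this assms] show ?thesis
    by simp
qed

text \<open>
  \<open>A\<close> commutes with multiples of the identity. Instead of multiplying power series, both sides are
  joined by the path \<open>z \<mapsto> exp ((x - z) B) (exp (c z) exp (z A))\<close> with \<open>B = A + c\<close>, whose derivative vanishes.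
\<close>

lemma mat_exp_add_diag:
  fixes A :: "real^'n^'n"
  shows "mat_exp (x *\<^sub>R (A + c *\<^sub>R mat 1)) = exp (c * x) *\<^sub>R mat_exp (x *\<^sub>R A)"
proof -
  define B where "B = A + c *\<^sub>R mat 1"
  define F where "F z = mat_exp ((x - z) *\<^sub>R B) ** (exp (c * z) *\<^sub>R mat_exp (z *\<^sub>R A))" for z
  note bb = bounded_bilinear_matrix_mult[where 'n='n and 'm='n and 'k='n]
  have "(F has_vector_derivative 0) (at z within S)" for z S
  proof -
    have "((\<lambda>z. x - z) has_vector_derivative - 1) (at z within S)"
      by (auto intro!: derivative_eq_intros)
    from vector_diff_chain_within[OF this mat_exp_has_vector_derivative]
    have 1: "((\<lambda>z. mat_exp ((x - z) *\<^sub>R B)) has_vector_derivative - (mat_exp ((x - z) *\<^sub>R B) ** B)) (at z within S)"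
      by (simp add: o_def)
    have 2: "((\<lambda>z. exp (c * z) *\<^sub>R mat_exp (z *\<^sub>R A)) has_vector_derivative
        B ** (exp (c * z) *\<^sub>R mat_exp (z *\<^sub>R A))) (at z within S)"
      by (rule has_vector_derivative_eq_rhs, 
          rule has_vector_derivative_scaleR[OF _ mat_exp_has_vector_derivative])
         (auto intro!: derivative_eq_intros simp: B_def mat_exp_commute algebra_simps
            bounded_bilinear.add_left[OF bb] bounded_bilinear.scaleR_left[OF bb] bounded_bilinear.scaleR_right[OF bb])
    show ?thesis
      unfolding F_def
      by (rule has_vector_derivative_eq_rhs, rule bounded_bilinear.has_vector_derivative[OF bb 1 2])
         (simp add: bounded_bilinear.minus_left[OF bb] matrix_mul_assoc)
  qed
  then have "F x = F 0"
    using has_vector_derivative_zero_constant[of UNIV F] by (metis UNIV_I convex_UNIV)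
  then show ?thesis
    by (simp add: F_def B_def)
qed

lemma mat_pow_nonneg:
  assumes "\<And>i j. 0 \<le> A $ i $ j"
  shows "0 \<le> mat_pow (A :: real^'n^'n) k $ i $ j"
proof (induction k arbitrary: i j)
  case (Suc k)
  then show ?case
    by (simp add: mat_pow_Suc matrix_matrix_mult_def sum_nonneg assms)
qed (simp add: mat_def)

lemma mat_exp_ge_mat_1:
  fixes A :: "real^'n^'n"
  assumes "\<And>i j. 0 \<le> A $ i $ j" and "0 \<le> x"
  shows "mat 1 $ i $ j \<le> mat_exp (x *\<^sub>R A) $ i $ j"
proof -
  have "(\<Sum>k\<in>{0}. mat_pow A k $ i $ j / fact k * x ^ k) \<le> (\<Sum>k. mat_pow A k $ i $ j / fact k * x ^ k)"
    using summable_mat_exp_entry mat_pow_nonneg[of A] assms by (intro sum_le_suminf) auto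
  also have "\<dots> = mat_exp (x *\<^sub>R A) $ i $ j"
    using mat_exp_entry_sums[of A i j x] by (simp add: sums_iff)
  finally show ?thesis by simp
qed

text \<open>
  Adding a large multiple \<open>c\<close> of the identity makes all entries nonnegative, and then every term of
  the power series is. The bound yields both nonnegativity of the transition probabilities and strict
  positivity of survival probabilities: a state is held up to time \<open>x\<close> with probability at least \<open>exp (- c x)\<close>.
\<close>

lemma mat_exp_Metzler_lower_bound:
  fixes A :: "real^'n^'n"
  assumes "\<And>i j. i \<noteq> j \<Longrightarrow> 0 \<le> A $ i $ j"
  shows "\<exists>c. \<forall>x\<ge>0. \<forall>i j. exp (- (c * x)) * mat 1 $ i $ j \<le> mat_exp (x *\<^sub>R A) $ i $ j"
proof -
  define c where "c = Max (range (\<lambda>i. \<bar>A $ i $ i\<bar>))"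
  have c: "\<bar>A $ i $ i\<bar> \<le> c" for i
    unfolding c_def by (rule Max_ge) auto
  define B where "B = A + c *\<^sub>R mat 1"
  have B: "0 \<le> B $ i $ j" for i j
    using assms[of i j] c[of i] by (auto simp: B_def mat_def)
  have "exp (- (c * x)) * mat 1 $ i $ j \<le> mat_exp (x *\<^sub>R A) $ i $ j" if "0 \<le> x" for x i j
  proof -
    have "mat 1 $ i $ j \<le> exp (c * x) * mat_exp (x *\<^sub>R A) $ i $ j"
      using mat_exp_ge_mat_1[of B x i j] B that by (simp add: B_def mat_exp_add_diag)
    then have "exp (- (c * x)) * mat 1 $ i $ j \<le> exp (- (c * x)) * (exp (c * x) * mat_exp (x *\<^sub>R A) $ i $ j)"
      by (rule mult_left_mono) simp
    also have "\<dots> = mat_exp (x *\<^sub>R A) $ i $ j"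
      by (simp add: exp_minus)
    finally show ?thesis .
  qed
  then show ?thesis by blast
qed

section \<open>Subgenerators and phase-type densities\<close>

text \<open>
  At a negative minimum \<open>m\<close> of \<open>v\<close> the conditions on \<open>T\<close> force \<open>(T v)\<^sub>m \<ge> 0\<close>, whence \<open>(r v - T v)\<^sub>m < 0\<close>.
\<close>

lemma subgenerator_minimum_principle:
  fixes T :: "real^'n^'n"
  assumes off: "\<And>i j. i \<noteq> j \<Longrightarrow> 0 \<le> T $ i $ j" and rows: "\<And>i. (\<Sum>j\<in>UNIV. T $ i $ j) \<le> 0"
    and r: "0 < r" and nonneg: "\<And>i. 0 \<le> (r *\<^sub>R v - T *v v) $ i"
  shows "0 \<le> v $ i"
proof (rule ccontr)
  assume neg: "\<not> 0 \<le> v $ i"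
  obtain m where m: "\<And>j. v $ m \<le> v $ j"
  proof -
    have "Min (range (($) v)) \<in> range (($) v)"
      by (rule Min_in) auto
    then obtain m where m: "v $ m = Min (range (($) v))" by (metis imageE)
    have "v $ m \<le> v $ j" for j
      unfolding m by (rule Min_le) auto
    then show ?thesis by (rule that)
  qed
  have "v $ m < 0"
    using neg m[of i] by linarith
  then have "0 \<le> (\<Sum>j\<in>UNIV. T $ m $ j) * v $ m"
    using rows[of m] by (simp add: zero_le_mult_iff)
  also have "\<dots> \<le> (\<Sum>j\<in>UNIV. T $ m $ j * v $ j)"
    unfolding sum_distrib_right
  proof (rule sum_mono)
    show "T $ m $ j * v $ m \<le> T $ m $ j * v $ j" for j
      using m[of j] off[of m j] by (cases "m = j") (auto intro: mult_left_mono)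
  qed
  also have "\<dots> = (T *v v) $ m"
    by (simp add: matrix_vector_mult_def)
  also have "\<dots> \<le> r * v $ m"
    using nonneg[of m] by simp
  finally show False
    using \<open>v $ m < 0\<close> r by (simp add: zero_le_mult_iff)
qed

text \<open>
  The minimum principle applied to both \<open>x\<close> and \<open>- x\<close> for \<open>x\<close> in the kernel.
\<close>

lemma invertible_resolvent:
  fixes T :: "real^'n^'n"
  assumes off: "\<And>i j. i \<noteq> j \<Longrightarrow> 0 \<le> T $ i $ j" and rows: "\<And>i. (\<Sum>j\<in>UNIV. T $ i $ j) \<le> 0"
    and r: "0 < r"
  shows "invertible (r *\<^sub>R mat 1 - T)"
proof -
  have "x = 0" if "(r *\<^sub>R mat 1 - T) *v x = 0" for x
  proof -
    have eq: "r *\<^sub>R x - T *v x = 0"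
      using that by (simp add: matrix_vector_mult_diff_rdistrib flip: scaleR_matrix_vector_assoc)
    have "0 \<le> x $ i" for i
      by (rule subgenerator_minimum_principle[OF off rows r]) (use eq in auto)
    moreover have "0 \<le> (- x) $ i" for i
    proof (rule subgenerator_minimum_principle[OF off rows r])
      have "r *\<^sub>R (- x) - T *v (- x) = - (r *\<^sub>R x - T *v x)"
        by (simp add: bounded_bilinear.minus_right[OF bounded_bilinear_matrix_vector_mult])
      then show "0 \<le> (r *\<^sub>R (- x) - T *v (- x)) $ i" for i
        using eq by simp
    qed
    ultimately show "x = 0"
      by (simp add: vec_eq_iff order_antisym)
  qed
  then show ?thesis
    using matrix_left_invertible_ker[of "r *\<^sub>R mat 1 - T"] by (simp add: invertible_left_inverse)
qed

lemma mat_exp_vector_has_derivative: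
  fixes A :: "real^'n^'n"
  shows "((\<lambda>x. \<nu> \<bullet> (mat_exp (x *\<^sub>R A) *v v)) has_real_derivative \<nu> \<bullet> (mat_exp (x *\<^sub>R A) *v (A *v v))) (at x within S)"
proof -
  have "((\<lambda>x. mat_exp (x *\<^sub>R A) *v v) has_vector_derivative (mat_exp (x *\<^sub>R A) ** A) *v v) (at x within S)"
    by (rule bounded_linear.has_vector_derivative[OF bounded_bilinear.bounded_linear_left[OF bounded_bilinear_matrix_vector_mult]
          mat_exp_has_vector_derivative])
  from bounded_linear.has_vector_derivative[OF bounded_linear_inner_right this, of \<nu>] show ?thesis
    by (simp add: has_real_derivative_iff_has_vector_derivative matrix_vector_mul_assoc)
qed

context
  fixes T :: "real^'n^'n" and \<nu> :: "real^'n"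
  assumes ph: "phase_type T \<nu>"
begin

lemma ph_offdiag_nonneg: "i \<noteq> j \<Longrightarrow> 0 \<le> T $ i $ j"
  and ph_row_sum_nonpos: "(\<Sum>j\<in>UNIV. T $ i $ j) \<le> 0"
  and ph_initial: "0 \<le> \<nu> $ i" "(\<Sum>i\<in>UNIV. \<nu> $ i) = 1"
  using ph by (auto simp: phase_type_def)

lemma absorption_rates_nonneg: "0 \<le> absorption_rates T $ i"
  using ph_row_sum_nonpos[of i] by (simp add: absorption_rates_def matrix_vector_mult_def)

lemma ph_mat_exp_lower_bound:
  "\<exists>c. \<forall>x\<ge>0. \<forall>i j. exp (- (c * x)) * mat 1 $ i $ j \<le> mat_exp (x *\<^sub>R T) $ i $ j"
  by (rule mat_exp_Metzler_lower_bound[of T]) (auto intro: ph_offdiag_nonneg)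

lemma mat_exp_nonneg: "0 \<le> x \<Longrightarrow> 0 \<le> mat_exp (x *\<^sub>R T) $ i $ j"
proof -
  obtain c where c: "\<And>x i j. 0 \<le> x \<Longrightarrow> exp (- (c * x)) * mat 1 $ i $ j \<le> mat_exp (x *\<^sub>R T) $ i $ j"
    using ph_mat_exp_lower_bound by blast
  have "0 \<le> exp (- (c * x)) * (mat 1 :: real^'n^'n) $ i $ j"
    by (simp add: mat_def)
  then show "0 \<le> x \<Longrightarrow> 0 \<le> mat_exp (x *\<^sub>R T) $ i $ j"
    using c[of x i j] by linarith
qed

lemma inner_mat_exp_nonneg:
  assumes "0 \<le> x" "\<And>i. 0 \<le> v $ i" "\<And>i. 0 \<le> w $ i"
  shows "0 \<le> w \<bullet> (mat_exp (x *\<^sub>R T) *v v)"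
  using assms by (auto simp: inner_vec_def matrix_vector_mult_def intro!: sum_nonneg mult_nonneg_nonneg mat_exp_nonneg)

lemma ph_density_nonneg: "0 \<le> ph_density T \<nu> x"
  by (auto simp: ph_density_def intro!: inner_mat_exp_nonneg absorption_rates_nonneg ph_initial)

lemma survival_pos:
  assumes "0 \<le> x"
  shows "0 < \<nu> \<bullet> (mat_exp (x *\<^sub>R T) *v 1)"
proof -
  obtain c where c: "\<And>x i j. 0 \<le> x \<Longrightarrow> exp (- (c * x)) * mat 1 $ i $ j \<le> mat_exp (x *\<^sub>R T) $ i $ j"
    using ph_mat_exp_lower_bound by blast
  have "0 < exp (- (c * x))" by simp
  also have "\<dots> = exp (- (c * x)) * (\<Sum>i\<in>UNIV. \<nu> $ i)"
    by (simp add: ph_initial)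
  also have "\<dots> = (\<Sum>i\<in>UNIV. \<nu> $ i * (\<Sum>j\<in>UNIV. exp (- (c * x)) * mat 1 $ i $ j))"
    by (simp add: mat_def if_distrib[of "(*) _"] sum_distrib_right[symmetric] mult.commute cong: if_cong)
  also have "\<dots> \<le> (\<Sum>i\<in>UNIV. \<nu> $ i * (\<Sum>j\<in>UNIV. mat_exp (x *\<^sub>R T) $ i $ j))"
    by (intro sum_mono mult_left_mono c ph_initial assms)
  also have "\<dots> = \<nu> \<bullet> (mat_exp (x *\<^sub>R T) *v 1)"
    by (simp add: inner_vec_def matrix_vector_mult_def)
  finally show ?thesis .
qed

text \<open>
  The survival probability from state \<open>i\<close>, the \<open>i\<close>-th row sum, starts at 1 and decreases at the rate of absorption.
\<close>

lemma mat_exp_entry_le_1: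
  assumes "0 \<le> x"
  shows "mat_exp (x *\<^sub>R T) $ i $ j \<le> 1"
proof -
  let ?S = "\<lambda>x. axis i 1 \<bullet> (mat_exp (x *\<^sub>R T) *v 1)"
  have "?S x \<le> ?S 0"
  proof (rule DERIV_nonpos_imp_nonincreasing[OF assms])
    fix y :: real assume "0 \<le> y"
    then have "0 \<le> axis i 1 \<bullet> (mat_exp (y *\<^sub>R T) *v absorption_rates T)"
      by (intro inner_mat_exp_nonneg absorption_rates_nonneg) (auto simp: axis_def)
    then have "axis i 1 \<bullet> (mat_exp (y *\<^sub>R T) *v (T *v 1)) \<le> 0"
      by (simp add: absorption_rates_def bounded_bilinear.minus_right[OF bounded_bilinear_matrix_vector_mult])
    then show "\<exists>z. (?S has_real_derivative z) (at y) \<and> z \<le> 0"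
      using mat_exp_vector_has_derivative by blast
  qed
  then have "(\<Sum>j\<in>UNIV. mat_exp (x *\<^sub>R T) $ i $ j) \<le> 1"
    by (simp add: inner_axis' matrix_vector_mult_def mat_def)
  moreover have "mat_exp (x *\<^sub>R T) $ i $ j \<le> (\<Sum>j\<in>UNIV. mat_exp (x *\<^sub>R T) $ i $ j)"
    by (rule member_le_sum) (auto intro: mat_exp_nonneg assms)
  ultimately show ?thesis by linarith
qed

lemma inner_mat_exp_bounded:
  assumes "0 \<le> x"
  shows "\<bar>\<nu> \<bullet> (mat_exp (x *\<^sub>R T) *v v)\<bar> \<le> (\<Sum>i\<in>UNIV. \<Sum>j\<in>UNIV. \<bar>\<nu> $ i\<bar> * \<bar>v $ j\<bar>)"
proof -
  have "\<nu> \<bullet> (mat_exp (x *\<^sub>R T) *v v) = (\<Sum>i\<in>UNIV. \<Sum>j\<in>UNIV. \<nu> $ i * (mat_exp (x *\<^sub>R T) $ i $ j * v $ j))"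
    by (simp add: inner_vec_def matrix_vector_mult_def sum_distrib_left)
  also have "\<bar>\<dots>\<bar> \<le> (\<Sum>i\<in>UNIV. \<Sum>j\<in>UNIV. \<bar>\<nu> $ i * (mat_exp (x *\<^sub>R T) $ i $ j * v $ j)\<bar>)"
    by (intro order_trans[OF sum_abs] sum_mono sum_abs)
  also have "\<dots> \<le> (\<Sum>i\<in>UNIV. \<Sum>j\<in>UNIV. \<bar>\<nu> $ i\<bar> * \<bar>v $ j\<bar>)"
    unfolding abs_mult using mat_exp_nonneg[OF assms] mat_exp_entry_le_1[OF assms]
    by (intro sum_mono mult_left_mono) (auto simp: mult_left_le_one_le)
  finally show ?thesis .
qed

lemma ph_density_measurable [measurable]: "ph_density T \<nu> \<in> borel_measurable borel"
proof -
  have [measurable]: "(\<lambda>x. \<nu> \<bullet> (mat_exp (x *\<^sub>R T) *v absorption_rates T)) \<in> borel_measurable borel"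
    by (intro borel_measurable_continuous_onI continuous_intros continuous_on_matrix_vector_mult)
  show ?thesis
    unfolding ph_density_def[abs_def] by measurable
qed

text \<open>
  If \<open>(r - T) v = t\<close>, an antiderivative of the tilted density is \<open>- exp (- r x) (\<nu> \<bullet> exp (x T) v)\<close>.
  For \<open>r = 0\<close> and \<open>v = 1\<close> this is minus the survival function.
\<close>

lemma ph_density_has_integral:
  assumes v: "r *\<^sub>R v - T *v v = absorption_rates T" and y: "0 \<le> y"
  shows "((\<lambda>x. exp (- (r * x)) * ph_density T \<nu> x) has_integral
    \<nu> \<bullet> v - exp (- (r * y)) * (\<nu> \<bullet> (mat_exp (y *\<^sub>R T) *v v))) {0..y}"
proof -
  define F where "F x = - (exp (- (r * x)) * (\<nu> \<bullet> (mat_exp (x *\<^sub>R T) *v v)))" for x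
  have "((\<lambda>x. exp (- (r * x)) * ph_density T \<nu> x) has_integral F y - F 0) {0..y}"
  proof (rule fundamental_theorem_of_calculus_interior[OF y])
    show "continuous_on {0..y} F"
      unfolding F_def by (intro continuous_intros continuous_on_matrix_vector_mult)
    fix x assume "x \<in> {0<..<y}"
    have "ph_density T \<nu> x = r * (\<nu> \<bullet> (mat_exp (x *\<^sub>R T) *v v)) - \<nu> \<bullet> (mat_exp (x *\<^sub>R T) *v (T *v v))"
      using \<open>x \<in> {0<..<y}\<close> unfolding ph_density_def v[symmetric]
      by (simp add: matrix_vector_mult_diff_distrib matrix_vector_mult_scaleR inner_diff_right)
    note density = this
    have "(F has_real_derivative exp (- (r * x)) * ph_density T \<nu> x) (at x)"
      unfolding F_def
      by (auto intro!: derivative_eq_intros mat_exp_vector_has_derivative simp: density algebra_simps)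
    then show "(F has_vector_derivative exp (- (r * x)) * ph_density T \<nu> x) (at x)"
      by (simp add: has_real_derivative_iff_has_vector_derivative)
  qed
  then show ?thesis
    by (simp add: F_def matrix_vector_mul_lid)
qed

lemma laplace_ph_density:
  assumes int: "integrable lborel (ph_density T \<nu>)" and r: "0 < r"
    and v: "r *\<^sub>R v - T *v v = absorption_rates T"
  shows "laplace (ph_density T \<nu>) r = \<nu> \<bullet> v"
proof -
  define f where "f x = exp (- (r * x)) * ph_density T \<nu> x" for x
  define F where "F x = exp (- (r * x)) * (\<nu> \<bullet> (mat_exp (x *\<^sub>R T) *v v))" for x
  have f_zero: "f x = 0" if "x \<le> 0" for x
    using that by (simp add: f_def ph_density_def)
  have f_int: "integrable lborel f"
  proof (rule Bochner_Integration.integrable_bound[OF int])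
    show "f \<in> borel_measurable lborel"
      unfolding f_def[abs_def] by measurable
    have "norm (f x) \<le> norm (ph_density T \<nu> x)" for x
    proof (cases "0 < x")
      case True
      then show ?thesis using r by (simp add: f_def abs_mult mult_left_le_one_le)
    qed (simp add: f_zero)
    then show "AE x in lborel. norm (f x) \<le> norm (ph_density T \<nu> x)" by simp
  qed
  have "(LINT x|lborel. f x) = \<nu> \<bullet> v"
  proof (rule tendsto_unique[OF _ tendsto_integral_at_top[OF _ f_int]])
    have part: "(LINT x|lborel. indicator {..y} x *\<^sub>R f x) = \<nu> \<bullet> v - F y" if "0 \<le> y" for y
    proof -
      have eq: "indicator {..y} x *\<^sub>R f x = indicator {0..y} x *\<^sub>R f x" for x
        by (auto simp: indicator_def f_zero)
      have "set_integrable lborel {0..y} f"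
        using f_int unfolding set_integrable_def by (intro integrable_mult_indicator) auto
      then have "(LINT x:{0..y}|lborel. f x) = integral {0..y} f"
        by (rule set_borel_integral_eq_integral)
      also have "\<dots> = \<nu> \<bullet> v - F y"
        using ph_density_has_integral[OF v that] unfolding f_def F_def by (rule integral_unique)
      finally show ?thesis
        by (simp only: eq set_lebesgue_integral_def)
    qed
    have "(F \<longlongrightarrow> 0) at_top"
    proof (rule Lim_null_comparison)
      define C where "C = (\<Sum>i\<in>UNIV. \<Sum>j\<in>UNIV. \<bar>\<nu> $ i\<bar> * \<bar>v $ j\<bar>)"
      show "\<forall>\<^sub>F x in at_top. norm (F x) \<le> exp (- (r * x)) * C"
        using eventually_ge_at_top[of 0]
        by eventually_elim (use inner_mat_exp_bounded in \<open>simp add: F_def C_def abs_mult\<close>)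
      show "((\<lambda>x. exp (- (r * x)) * C) \<longlongrightarrow> 0) at_top"
        using r by (intro tendsto_mult_left_zero filterlim_compose[OF exp_at_bot]
            filterlim_compose[OF filterlim_uminus_at_bot_at_top] filterlim_tendsto_pos_mult_at_top[OF tendsto_const]
            filterlim_ident)
    qed
    from tendsto_diff[OF tendsto_const this, of "\<nu> \<bullet> v"]
    have "((\<lambda>y. \<nu> \<bullet> v - F y) \<longlongrightarrow> \<nu> \<bullet> v) at_top"
      by simp
    moreover have "\<forall>\<^sub>F y in at_top. \<nu> \<bullet> v - F y = (LINT x|lborel. indicator {..y} x *\<^sub>R f x)"
      using eventually_ge_at_top[of 0] by eventually_elim (simp only: part)
    ultimately show "((\<lambda>y. LINT x|lborel. indicator {..y} x *\<^sub>R f x) \<longlongrightarrow> \<nu> \<bullet> v) at_top"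
      by (rule Lim_transform_eventually)
  qed auto
  moreover have "laplace (ph_density T \<nu>) r = (LINT x|lborel. f x)"
    unfolding laplace_def set_lebesgue_integral_def
    by (intro Bochner_Integration.integral_cong refl) (auto simp: f_def indicator_def ph_density_def)
  ultimately show ?thesis by simp
qed

end

section \<open>Uniqueness of the Laplace transform\<close>

text \<open>
  Let \<open>k x = exp (- s x) g x\<close> for a large \<open>s\<close>. The transforms at \<open>s, s + 1, s + 2, \<dots>\<close> say that \<open>k\<close> is
  orthogonal to all powers of \<open>exp (- x)\<close>, hence, \<open>k\<close> being integrable, to \<open>q (exp (- x))\<close> for every continuous \<open>q\<close> on
  \<open>[0, 1]\<close>. Choosing \<open>q (exp (- x))\<close> as \<open>g\<close> times a positive cutoff leaves a weighted integral of \<open>g\<^sup>2\<close>,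
  which is 0 only if \<open>g\<close> is.
\<close>

lemma laplace_transform_eq_0_imp_eq_0:
  fixes g :: "real \<Rightarrow> real"
  assumes cont: "continuous_on {0..} g"
    and transform: "\<forall>\<^sub>F s in at_top. set_integrable lborel {0..} (\<lambda>x. exp (- (s * x)) * g x) \<and>
      (LINT x:{0..}|lborel. exp (- (s * x)) * g x) = 0"
    and y: "0 \<le> y"
  shows "g y = 0"
proof -
  obtain s where s: "\<And>r. s \<le> r \<Longrightarrow> set_integrable lborel {0..} (\<lambda>x. exp (- (r * x)) * g x)"
      "\<And>r. s \<le> r \<Longrightarrow> (LINT x:{0..}|lborel. exp (- (r * x)) * g x) = 0"
    using transform unfolding eventually_at_top_linorder by blast
  define k where "k x = indicator {0..} x * (exp (- (s * x)) * g x)" for x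
  have k_int: "integrable lborel k"
    using s(1)[of s] by (simp add: k_def[abs_def] set_integrable_def)
  have [measurable]: "k \<in> borel_measurable borel"
    using borel_measurable_integrable[OF k_int] by simp
  have exp_le_1: "exp (- x) \<in> {0..1}" if "0 \<le> x" for x :: real
    using that by simp
  have monomial: "integrable lborel (\<lambda>x. exp (- x) ^ n * k x)" "(LINT x|lborel. exp (- x) ^ n * k x) = 0" for n :: nat
  proof -
    have eq: "exp (- x) ^ n * k x = indicator {0..} x * (exp (- ((s + real n) * x)) * g x)" for x
      by (simp add: k_def exp_of_nat_mult[symmetric] mult_exp_exp algebra_simps)
    show "integrable lborel (\<lambda>x. exp (- x) ^ n * k x)" "(LINT x|lborel. exp (- x) ^ n * k x) = 0"
      using s[of "s + real n"] unfolding eq by (simp_all add: set_integrable_def set_lebesgue_integral_def)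
  qed
  have cont_zero: "(LINT x|lborel. q (exp (- x)) * k x) = 0"
    if q: "continuous_on UNIV q" for q :: "real \<Rightarrow> real"
  proof (rule ccontr)
    define J where "J = \<bar>LINT x|lborel. q (exp (- x)) * k x\<bar>"
    \<comment> \<open>\<open>e\<close> times the norm of \<open>k\<close> is smaller than \<open>J\<close>; the summand 1 keeps the denominator positive if the norm is 0.\<close>
    define e where "e = J / (2 * (LINT x|lborel. \<bar>k x\<bar>) + 1)"
    have norm_nonneg: "0 \<le> (LINT x|lborel. \<bar>k x\<bar>)"
      by simp
    assume "(LINT x|lborel. q (exp (- x)) * k x) \<noteq> 0"
    then have "0 < J" "0 < e"
      using norm_nonneg by (simp_all add: J_def e_def add_nonneg_pos)
    have [measurable]: "q \<in> borel_measurable borel"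
      using q by (rule borel_measurable_continuous_onI)
    obtain p where "real_polynomial_function p" and p: "\<And>u. u \<in> {0..1} \<Longrightarrow> \<bar>q u - p u\<bar> < e"
      using Stone_Weierstrass_real_polynomial_function[of "{0..1}" q e] \<open>0 < e\<close> q
      by (metis compact_Icc continuous_on_subset subset_UNIV)
    then obtain c n where p_eq: "p = (\<lambda>u. \<Sum>i\<le>n. c i * u ^ i)"
      using real_polynomial_function_iff_sum by metis
    have p_int: "integrable lborel (\<lambda>x. p (exp (- x)) * k x)"
      unfolding p_eq sum_distrib_right mult.assoc by (intro Bochner_Integration.integrable_sum integrable_mult_right monomial)
    have p_zero: "(LINT x|lborel. p (exp (- x)) * k x) = 0"
      unfolding p_eq sum_distrib_right mult.assoc
      by (subst Bochner_Integration.integral_sum) (auto intro!: integrable_mult_right monomial simp: monomial)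
    have close: "\<bar>(q (exp (- x)) - p (exp (- x))) * k x\<bar> \<le> e * \<bar>k x\<bar>" for x
    proof (cases "0 \<le> x")
      case True
      then show ?thesis
        using p[OF exp_le_1[OF True]] by (simp add: abs_mult mult_right_mono)
    qed (simp add: k_def)
    have [measurable]: "p \<in> borel_measurable borel"
      unfolding p_eq by measurable
    have diff_int: "integrable lborel (\<lambda>x. (q (exp (- x)) - p (exp (- x))) * k x)"
      by (rule Bochner_Integration.integrable_bound[where f="\<lambda>x. e * \<bar>k x\<bar>"]) 
         (use k_int close \<open>0 < e\<close> in \<open>auto simp: abs_mult\<close>)
    have "J = \<bar>LINT x|lborel. (q (exp (- x)) - p (exp (- x))) * k x + p (exp (- x)) * k x\<bar>"
      by (simp add: J_def left_diff_distrib)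
    also have "\<dots> = \<bar>LINT x|lborel. (q (exp (- x)) - p (exp (- x))) * k x\<bar>"
      by (subst Bochner_Integration.integral_add[OF diff_int p_int]) (simp add: p_zero)
    also have "\<dots> \<le> (LINT x|lborel. \<bar>(q (exp (- x)) - p (exp (- x))) * k x\<bar>)"
      by (rule integral_abs_bound)
    also have "\<dots> \<le> (LINT x|lborel. e * \<bar>k x\<bar>)"
      using diff_int k_int close by (intro integral_mono) auto
    also have "\<dots> = e * (LINT x|lborel. \<bar>k x\<bar>)"
      by simp
    also have "\<dots> < J"
      using \<open>0 < J\<close> norm_nonneg unfolding e_def by (simp add: divide_simps; simp add: algebra_simps; linarith)
    finally show False by simp
  qed
  \<comment> \<open>The cutoff decreases linearly from 1 to 0 on \<open>[0, R]\<close>; \<open>w\<close> inverts \<open>x \<mapsto> exp (- x)\<close> on this interval.\<close>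
  define R where "R = y + 1"
  define w where "w u = - ln (max u (exp (- R)))" for u
  define q where "q u = g (max 0 (w u)) * (1 - w u / R)" for u
  have "0 < R"
    using y by (simp add: R_def)
  have w_cont: "continuous_on UNIV w"
    unfolding w_def by (intro continuous_intros) (smt (verit) exp_gt_zero)
  have "continuous_on UNIV (\<lambda>u. g (max 0 (w u)))"
    by (rule continuous_on_compose2[OF cont]) (auto intro!: continuous_intros w_cont)
  then have q_cont: "continuous_on UNIV q"
    unfolding q_def using \<open>0 < R\<close> by (intro continuous_intros w_cont) auto
  define f where "f x = exp (- (s * x)) * (g x)\<^sup>2 * (1 - x / R)" for x
  have w_exp: "w (exp (- x)) = min x R" for x
    by (simp add: w_def max_def min_def)
  have q_k: "q (exp (- x)) * k x = indicator {0..R} x * f x" for x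
    using \<open>0 < R\<close> by (auto simp: q_def k_def f_def w_exp indicator_def power2_eq_square min_def)
  have f_cont: "continuous_on {0..R} f"
    unfolding f_def using \<open>0 < R\<close> by (intro continuous_intros continuous_on_subset[OF cont]) auto
  have "(LINT x:{0..R}|lborel. f x) = 0"
    using cont_zero[OF q_cont] by (simp add: q_k set_lebesgue_integral_def)
  then have "integral {0..R} f = 0"
    using set_borel_integral_eq_integral(2)[of "{0..R}" f] borel_integrable_atLeastAtMost'[OF f_cont] by simp
  moreover have "0 \<le> f x" if "x \<in> {0..R}" for x
    using that \<open>0 < R\<close> by (simp add: f_def)
  ultimately have "f y = 0"
    using integral_eq_0_iff[OF f_cont] \<open>0 < R\<close> y by (simp add: R_def)
  then show ?thesis
    using y by (simp add: f_def R_def)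
qed

section \<open>The delay equation of the scale function\<close>

lemma has_bochner_integral_exp_atLeast_0:
  assumes "0 < (r::real)"
  shows "has_bochner_integral lborel (\<lambda>x. indicator {0..} x * exp (- (r * x))) (1 / r)"
proof -
  have "(\<integral>\<^sup>+x. ennreal (exp (- (r * x))) * indicator {0..} x \<partial>lborel) = ennreal (0 - (- exp (- (r * 0)) / r))"
  proof (rule nn_integral_FTC_atLeast)
    show "((\<lambda>x. - exp (- (r * x)) / r) has_real_derivative exp (- (r * x))) (at x)" for x
      using assms by (auto intro!: derivative_eq_intros)
    have "((\<lambda>x. exp (- (r * x))) \<longlongrightarrow> 0) at_top"
      using assms by (intro filterlim_compose[OF exp_at_bot] filterlim_compose[OF filterlim_uminus_at_bot_at_top]
          filterlim_tendsto_pos_mult_at_top[OF tendsto_const] filterlim_ident)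
    from tendsto_divide[OF tendsto_minus[OF this] tendsto_const[of r]]
    show "((\<lambda>x. - exp (- (r * x)) / r) \<longlongrightarrow> 0) at_top"
      using assms by simp
  qed auto
  also have "(\<lambda>x. ennreal (exp (- (r * x))) * indicator {0..} x) = (\<lambda>x. ennreal (indicator {0..} x * exp (- (r * x))))"
    by (auto simp: indicator_def)
  finally show ?thesis
    using assms by (intro has_bochner_integral_nn_integral) auto
qed

text \<open>
  The interval from 0 to \<open>x\<close> is empty for \<open>x < 0\<close>, so the primitive vanishes on the negative half-line
  together with its derivative. The delay equation uses this convention to extend its solution by 0.
\<close>

lemma primitive_has_vector_derivative:
  fixes H :: "real \<Rightarrow> 'a::euclidean_space"
  assumes cont: "continuous_on {0..} H" and "x \<noteq> 0"
  shows "((\<lambda>x. integral {0..x} H) has_vector_derivative (if x < 0 then 0 else H x)) (at x)"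
proof (cases "x < 0")
  case True
  have "((\<lambda>_. 0 :: 'a) has_vector_derivative 0) (at x)"
    by simp
  from has_vector_derivative_transform_within_open[OF this, of "{..<0}" "\<lambda>x. integral {0..x} H"] show ?thesis
    using True by simp
next
  case False
  then have "0 < x" using assms by simp
  have "((\<lambda>x. integral {0..x} H) has_vector_derivative H x) (at x within {0..x + 1})"
    using \<open>0 < x\<close> by (intro integral_has_vector_derivative continuous_on_subset[OF cont]) auto
  then show ?thesis
    using \<open>0 < x\<close> by (simp add: at_within_Icc_at)
qed

lemma continuous_on_primitive:
  fixes H :: "real \<Rightarrow> 'a::euclidean_space"
  assumes cont: "continuous_on {0..} H"
  shows "continuous_on UNIV (\<lambda>x. integral {0..x} H)"
proof -
  have "isCont (\<lambda>x. integral {0..x} H) x" if "x \<noteq> 0" for x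
    using primitive_has_vector_derivative[OF cont that] by (rule has_vector_derivative_continuous)
  moreover have "isCont (\<lambda>x. integral {0..x} H) 0"
    unfolding isCont_def filterlim_at_split
  proof
    have "continuous_on {0..1} (\<lambda>x. integral {0..x} H)"
      by (intro indefinite_integral_continuous_1 integrable_continuous_interval continuous_on_subset[OF cont]) auto
    then show "((\<lambda>x. integral {0..x} H) \<longlongrightarrow> integral {0..0} H) (at_right 0)"
      by (rule continuous_on_Icc_at_rightD) simp
    show "((\<lambda>x. integral {0..x} H) \<longlongrightarrow> integral {0..0} H) (at_left 0)"
      by (rule tendsto_eventually) (simp add: eventually_at_filter)
  qed
  ultimately show ?thesis
    by (metis continuous_at_imp_continuous_on)
qed

text \<open>
  Integration by parts. Integrability of \<open>exp (- s\<^sub>0 x) H x\<close> bounds the primitive by a multiple of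
  \<open>exp (s\<^sub>0 x)\<close>, which makes its transform converge at \<open>s > s\<^sub>0\<close> and kills the boundary term.
\<close>

lemma laplace_transform_primitive:
  fixes H :: "real \<Rightarrow> 'a::euclidean_space"
  assumes cont: "continuous_on {0..} H"
    and int: "set_integrable lborel {0..} (\<lambda>x. exp (- (s\<^sub>0 * x)) *\<^sub>R H x)" "0 \<le> s\<^sub>0"
    and s: "s\<^sub>0 < s" 
    and hat: "has_bochner_integral lborel (\<lambda>x. indicator {0..} x *\<^sub>R (exp (- (s * x)) *\<^sub>R H x)) h"
  shows "has_bochner_integral lborel (\<lambda>x. indicator {0..} x *\<^sub>R (exp (- (s * x)) *\<^sub>R integral {0..x} H)) (h /\<^sub>R s)"
proof -
  define I where "I x = integral {0..x} H" for x
  define C where "C = (LINT x:{0..}|lborel. norm (exp (- (s\<^sub>0 * x)) *\<^sub>R H x))"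
  define f where "f x = exp (- (s * x)) *\<^sub>R H x" for x
  define g where "g x = exp (- (s * x)) *\<^sub>R I x" for x
  have I_cont: "continuous_on UNIV I"
    unfolding I_def by (rule continuous_on_primitive[OF cont])
  have I_bound: "norm (I x) \<le> exp (s\<^sub>0 * x) * C" if "0 \<le> x" for x
  proof -
    define k where "k u = norm (exp (- (s\<^sub>0 * u)) *\<^sub>R H u)" for u
    have H_cont: "continuous_on {0..x} H"
      by (rule continuous_on_subset[OF cont]) auto
    then have k_cont: "continuous_on {0..x} k"
      unfolding k_def by (intro continuous_intros)
    have k_int: "set_integrable lborel {0..} k"
      unfolding k_def by (rule set_integrable_norm[OF int(1)])
    have "integral {0..x} k = (LINT u:{0..x}|lborel. k u)"
      by (rule set_borel_integral_eq_integral(2)[symmetric], rule borel_integrable_atLeastAtMost'[OF k_cont])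
    also have "\<dots> \<le> C"
      unfolding C_def k_def[symmetric] using k_int set_integrable_subset[OF k_int, of "{0..x}"]
      unfolding set_lebesgue_integral_def set_integrable_def
      by (intro integral_mono) (auto simp: indicator_def k_def)
    finally have k_le: "integral {0..x} k \<le> C" .
    have "norm (I x) \<le> integral {0..x} (\<lambda>u. exp (s\<^sub>0 * x) * k u)"
      unfolding I_def
    proof (rule integral_norm_bound_integral)
      show "H integrable_on {0..x}" "(\<lambda>u. exp (s\<^sub>0 * x) * k u) integrable_on {0..x}"
        by (intro integrable_continuous_interval H_cont continuous_intros k_cont)+
      fix u assume u: "u \<in> {0..x}"
      then have "1 \<le> exp (s\<^sub>0 * x) * exp (- (s\<^sub>0 * u))"
        using int(2) by (simp add: mult_exp_exp mult_left_mono)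
      from mult_right_mono[OF this norm_ge_zero[of "H u"]]
      show "norm (H u) \<le> exp (s\<^sub>0 * x) * k u"
        by (simp add: k_def mult.assoc)
    qed
    also have "\<dots> = exp (s\<^sub>0 * x) * integral {0..x} k"
      by simp
    also have "\<dots> \<le> exp (s\<^sub>0 * x) * C"
      using k_le by simp
    finally show ?thesis .
  qed
  have g_bound: "norm (g x) \<le> C * exp (- ((s - s\<^sub>0) * x))" if "0 \<le> x" for x
  proof -
    have "norm (g x) \<le> exp (- (s * x)) * (exp (s\<^sub>0 * x) * C)"
      using I_bound[OF that] by (simp add: g_def)
    also have "\<dots> = C * exp (- ((s - s\<^sub>0) * x))"
      by (simp add: mult_exp_exp algebra_simps)
    finally show ?thesis .
  qed
  have "continuous_on UNIV g"
    unfolding g_def by (intro continuous_intros I_cont)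
  then have [measurable]: "g \<in> borel_measurable borel"
    by (rule borel_measurable_continuous_onI)
  have g_int: "integrable lborel (\<lambda>x. indicator {0..} x *\<^sub>R g x)"
  proof (rule Bochner_Integration.integrable_bound)
    have "has_bochner_integral lborel (\<lambda>x. indicator {0..} x * exp (- ((s - s\<^sub>0) * x))) (1 / (s - s\<^sub>0))"
      using s by (intro has_bochner_integral_exp_atLeast_0) simp
    then show "integrable lborel (\<lambda>x. C * (indicator {0..} x * exp (- ((s - s\<^sub>0) * x))))"
      by (intro integrable_mult_right) (simp add: has_bochner_integral_iff)
    have "norm (indicator {0..} x *\<^sub>R g x) \<le> norm (C * (indicator {0..} x * exp (- ((s - s\<^sub>0) * x))))" for x
      using g_bound[of x] by (cases "0 \<le> x") (auto intro: order_trans[OF _ abs_ge_self])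
    then show "AE x in lborel. norm (indicator {0..} x *\<^sub>R g x) \<le> norm (C * (indicator {0..} x * exp (- ((s - s\<^sub>0) * x))))"
      by simp
  qed simp
  have f_int: "integrable lborel (\<lambda>x. indicator {0..} x *\<^sub>R f x)"
    using hat by (simp add: has_bochner_integral_iff f_def)
  have parts: "(LINT x|lborel. indicator {..R} x *\<^sub>R (indicator {0..} x *\<^sub>R (f x - s *\<^sub>R g x))) = g R" if "0 \<le> R" for R
  proof -
    have cont_R: "continuous_on {0..R} (\<lambda>x. f x - s *\<^sub>R g x)"
      unfolding f_def by (intro continuous_intros continuous_on_subset[OF cont] continuous_on_subset[OF \<open>continuous_on UNIV g\<close>]) auto
    have "(LINT x|lborel. indicator {0..R} x *\<^sub>R (f x - s *\<^sub>R g x)) = g R - g 0"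
    proof (rule integral_FTC_atLeastAtMost[OF that _ cont_R])
      fix x assume x: "0 \<le> x" "x \<le> R"
      have "(I has_vector_derivative H x) (at x within {0..R})"
        unfolding I_def using x by (intro integral_has_vector_derivative continuous_on_subset[OF cont]) auto
      moreover have "((\<lambda>x. exp (- (s * x))) has_real_derivative - s * exp (- (s * x))) (at x within {0..R})"
        by (auto intro!: derivative_eq_intros)
      ultimately show "(g has_vector_derivative f x - s *\<^sub>R g x) (at x within {0..R})"
        unfolding g_def f_def
        by (rule has_vector_derivative_eq_rhs[OF has_vector_derivative_scaleR[rotated]]) simp
    qed
    also have "g 0 = 0"
      by (simp add: g_def I_def)
    also have "(\<lambda>x. indicator {0..R} x *\<^sub>R (f x - s *\<^sub>R g x)) =
        (\<lambda>x. indicator {..R} x *\<^sub>R (indicator {0..} x *\<^sub>R (f x - s *\<^sub>R g x)))"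
      by (auto simp: indicator_def)
    finally show ?thesis by simp
  qed
  have fg_int: "integrable lborel (\<lambda>x. indicator {0..} x *\<^sub>R (f x - s *\<^sub>R g x))"
    using Bochner_Integration.integrable_diff[OF f_int integrable_scaleR_right[OF g_int, of s]]
    by (simp add: scaleR_diff_right mult.commute)
  have "(LINT x|lborel. indicator {0..} x *\<^sub>R (f x - s *\<^sub>R g x)) = 0"
  proof (rule tendsto_unique[OF _ tendsto_integral_at_top[OF _ fg_int]])
    have "(g \<longlongrightarrow> 0) at_top"
    proof (rule Lim_null_comparison)
      show "\<forall>\<^sub>F x in at_top. norm (g x) \<le> C * exp (- ((s - s\<^sub>0) * x))"
        using eventually_ge_at_top[of 0] by eventually_elim (rule g_bound)
      show "((\<lambda>x. C * exp (- ((s - s\<^sub>0) * x))) \<longlongrightarrow> 0) at_top"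
        using s by (intro tendsto_mult_right_zero filterlim_compose[OF exp_at_bot] 
           filterlim_compose[OF filterlim_uminus_at_bot_at_top]
           filterlim_tendsto_pos_mult_at_top[OF tendsto_const] filterlim_ident) auto
    qed
    then show "((\<lambda>y. LINT x|lborel. indicator {..y} x *\<^sub>R (indicator {0..} x *\<^sub>R (f x - s *\<^sub>R g x))) \<longlongrightarrow> 0) at_top"
      by (rule Lim_transform_eventually) (use eventually_ge_at_top[of 0] in eventually_elim, simp only: parts)
  qed auto
  moreover have "(LINT x|lborel. indicator {0..} x *\<^sub>R (f x - s *\<^sub>R g x)) =
      h - s *\<^sub>R (LINT x|lborel. indicator {0..} x *\<^sub>R g x)"
  proof -
    have "(LINT x|lborel. indicator {0..} x *\<^sub>R (f x - s *\<^sub>R g x)) = 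
        (LINT x|lborel. indicator {0..} x *\<^sub>R f x - s *\<^sub>R (indicator {0..} x *\<^sub>R g x))"
      by (simp add: scaleR_diff_right mult.commute)
    also have "\<dots> = (LINT x|lborel. indicator {0..} x *\<^sub>R f x) - (LINT x|lborel. s *\<^sub>R (indicator {0..} x *\<^sub>R g x))"
      by (intro Bochner_Integration.integral_diff f_int integrable_scaleR_right g_int)
    also have "(LINT x|lborel. indicator {0..} x *\<^sub>R f x) = h"
      using hat by (simp add: has_bochner_integral_iff f_def)
    finally show ?thesis by (simp only: integral_scaleR_right)
  qed
  ultimately have h_eq: "h = s *\<^sub>R (LINT x|lborel. indicator {0..} x *\<^sub>R g x)"
    by simp
  have "(LINT x|lborel. indicator {0..} x *\<^sub>R g x) = h /\<^sub>R s"
    unfolding h_eq using s int(2) by simp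
  then show ?thesis
    using g_int by (simp add: has_bochner_integral_iff g_def I_def)
qed

lemma matrix_inv_right:
  fixes A :: "real^'n^'n"
  assumes "invertible A"
  shows "A ** matrix_inv A = mat 1"
  using assms unfolding invertible_def matrix_inv_def by (rule someI2_ex) blast

lemma outer_mult_vector: "outer u v *v x = (v \<bullet> x) *\<^sub>R u"
  by (simp add: vec_eq_iff outer_def matrix_vector_mult_def inner_vec_def sum_distrib_left mult_ac)

text \<open>
  For large \<open>s\<close> the term \<open>r s\<close> on the diagonal dominates the remaining terms, which stay bounded.
\<close>

lemma invertible_large_shift:
  fixes A :: "real^'n^'n" and t \<nu> :: "real^'n"
  assumes "0 < r" "0 < d"
  shows "\<forall>\<^sub>F s in at_top. invertible (A + (r * s) *\<^sub>R mat 1 + exp (- (d * s)) *\<^sub>R outer t \<nu>)"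
proof -
  define K where "K = onorm ((*v) A) + norm \<nu> * norm t"
  have inv: "invertible (A + (r * s) *\<^sub>R mat 1 + exp (- (d * s)) *\<^sub>R outer t \<nu>)" if s: "0 < s" "K < r * s" for s
  proof -
    have "x = 0" if "(A + (r * s) *\<^sub>R mat 1 + exp (- (d * s)) *\<^sub>R outer t \<nu>) *v x = 0" for x
    proof (rule ccontr)
      assume "x \<noteq> 0"
      have "A *v x + (r * s) *\<^sub>R x + exp (- (d * s)) *\<^sub>R ((\<nu> \<bullet> x) *\<^sub>R t) = 0"
        using that by (simp only: matrix_vector_mult_add_rdistrib flip: scaleR_matrix_vector_assoc)
          (simp add: outer_mult_vector)
      then have eq: "(r * s) *\<^sub>R x = - (A *v x + exp (- (d * s)) *\<^sub>R ((\<nu> \<bullet> x) *\<^sub>R t))"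
        by (simp only: eq_neg_iff_add_eq_0 ac_simps)
      have "(r * s) * norm x = norm ((r * s) *\<^sub>R x)"
        using s \<open>0 < r\<close> by simp
      also have "\<dots> = norm (A *v x + exp (- (d * s)) *\<^sub>R ((\<nu> \<bullet> x) *\<^sub>R t))"
        unfolding eq by (rule norm_minus_cancel)
      also have "\<dots> \<le> norm (A *v x) + exp (- (d * s)) * (\<bar>\<nu> \<bullet> x\<bar> * norm t)"
        by (rule order_trans[OF norm_triangle_ineq]) (simp add: abs_mult)
      also have "\<dots> \<le> onorm ((*v) A) * norm x + 1 * ((norm \<nu> * norm x) * norm t)"
        using s \<open>0 < d\<close> by (intro add_mono mult_mono onorm matrix_vector_mul_bounded_linear Cauchy_Schwarz_ineq2) auto
      also have "\<dots> = K * norm x"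
        by (simp add: K_def algebra_simps)
      finally show False
        using \<open>x \<noteq> 0\<close> s by simp
    qed
    then show ?thesis
      using matrix_left_invertible_ker by (subst invertible_left_inverse) blast
  qed
  have "\<forall>\<^sub>F s in at_top. 0 < s \<and> K < r * s"
    using eventually_gt_at_top[of 0] eventually_gt_at_top[of "K / r"]
    by eventually_elim (use \<open>0 < r\<close> in \<open>simp add: pos_divide_less_eq mult.commute\<close>)
  then show ?thesis
    by (rule eventually_mono) (use inv in blast)
qed

text \<open>
  The integrated form of \<open>r H' x + A H x + (\<nu> \<bullet> H (x - d)) t = 0\<close>, \<open>H 0 = p / r\<close>, with \<open>H\<close> extended by 0 to negative
  arguments. The solution has a kink at \<open>d\<close>, where the delayed term sets in.
\<close>

definition delay_solution ::
  "real \<Rightarrow> real \<Rightarrow> real^'n^'n \<Rightarrow> real^'n \<Rightarrow> real^'n \<Rightarrow> real^'n \<Rightarrow> (real \<Rightarrow> real^'n) \<Rightarrow> bool" where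
  "delay_solution r d A t \<nu> p H \<longleftrightarrow> continuous_on {0..} H \<and>
    (\<forall>x\<ge>0. r *\<^sub>R H x + A *v integral {0..x} H + (\<nu> \<bullet> integral {0..x - d} H) *\<^sub>R t = p)"

text \<open>
  The defect \<open>V\<close> of the equation has Laplace transform \<open>(F s (F s)\<inverse> p - p) / s = 0\<close>, where \<open>F s\<close> is the matrix whose
  inverse is the transform of \<open>W\<close>.
\<close>

lemma scale_function_delay_solution:
  fixes A :: "real^'n^'n" and t \<nu> p :: "real^'n" and W :: "real \<Rightarrow> real^'n^'n"
  assumes r: "0 < r" and d: "0 < d"
    and W_cont: "continuous_on {0..} W"
    and W_transform: "\<forall>\<^sub>F s in at_top.
       set_integrable lborel {0..} (\<lambda>x. exp (- (s * x)) *\<^sub>R W x) \<and>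
       (LINT x:{0..}|lborel. exp (- (s * x)) *\<^sub>R W x) =
         matrix_inv (A + (r * s) *\<^sub>R mat 1 + exp (- (d * s)) *\<^sub>R outer t \<nu>)"
  shows "delay_solution r d A t \<nu> p (\<lambda>x. W x *v p)"
proof -
  define H where "H x = W x *v p" for x
  define I where "I x = integral {0..x} H" for x
  define V where "V x = r *\<^sub>R H x + A *v I x + (\<nu> \<bullet> I (x - d)) *\<^sub>R t - p" for x
  define F where "F s = A + (r * s) *\<^sub>R mat 1 + exp (- (d * s)) *\<^sub>R outer t \<nu>" for s
  have lin: "bounded_linear (\<lambda>B :: real^'n^'n. B *v p)"
    by (rule bounded_bilinear.bounded_linear_left[OF bounded_bilinear_matrix_vector_mult])
  have H_cont: "continuous_on {0..} H"
    unfolding H_def by (intro continuous_on_matrix_vector_mult W_cont continuous_intros)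
  have I_cont: "continuous_on UNIV I"
    unfolding I_def by (rule continuous_on_primitive[OF H_cont])
  have I_neg: "I x = 0" if "x < 0" for x
    using that by (simp add: I_def)
  have V_cont: "continuous_on {0..} V"
    unfolding V_def
    by (intro continuous_intros continuous_on_matrix_vector_mult H_cont continuous_on_compose2[OF I_cont]) auto
  \<comment> \<open>\<open>L s f v\<close>: the Laplace transform of \<open>f\<close> converges at \<open>s\<close> and equals \<open>v\<close>.\<close>
  define L where "L s f v \<longleftrightarrow> has_bochner_integral lborel (\<lambda>x. indicator {0..} x *\<^sub>R (exp (- (s * x)) *\<^sub>R f x)) v"
    for s :: real and f :: "real \<Rightarrow> real^'n" and v
  obtain S where S: "\<And>s. S \<le> s \<Longrightarrow> set_integrable lborel {0..} (\<lambda>x. exp (- (s * x)) *\<^sub>R W x)"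
    "\<And>s. S \<le> s \<Longrightarrow> (LINT x:{0..}|lborel. exp (- (s * x)) *\<^sub>R W x) = matrix_inv (F s)"
    "\<And>s. S \<le> s \<Longrightarrow> invertible (F s)"
    using eventually_conj[OF W_transform invertible_large_shift[OF r d, of A t \<nu>]]
    unfolding eventually_at_top_linorder F_def by blast
  have L_H: "L s H (matrix_inv (F s) *v p)" if "S \<le> s" for s
  proof -
    have "has_bochner_integral lborel (\<lambda>x. indicator {0..} x *\<^sub>R (exp (- (s * x)) *\<^sub>R W x)) (matrix_inv (F s))"
      using S(1,2)[OF that] by (simp add: has_bochner_integral_iff set_integrable_def set_lebesgue_integral_def)
    from has_bochner_integral_bounded_linear[OF lin this] show ?thesis
      by (simp add: L_def H_def scaleR_matrix_vector_assoc)
  qed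
  have L_V: "L s V 0" if s: "max S 0 < s" for s
  proof -
    define h where "h = matrix_inv (F s) *v p"
    have "0 < s" using s by simp
    have Fh: "F s *v h = p"
      using S(3)[of s] s by (simp add: h_def matrix_vector_mul_assoc matrix_inv_right)
    have H: "L s H h"
      using L_H[of s] s by (simp add: h_def)
    have "L s I (h /\<^sub>R s)"
      unfolding L_def I_def
    proof (rule laplace_transform_primitive[OF H_cont _ _ s])
      show "set_integrable lborel {0..} (\<lambda>x. exp (- (max S 0 * x)) *\<^sub>R H x)"
        using L_H[of "max S 0"] by (simp add: L_def set_integrable_def has_bochner_integral_iff)
    qed (use H L_def in auto)
    then have I: "L s I (h /\<^sub>R s)" .
    define g where "g x = indicator {0..} x *\<^sub>R (exp (- (s * x)) *\<^sub>R I x)" for x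
    have g_shift: "exp (- (d * s)) *\<^sub>R g (- d + 1 * x) = indicator {0..} x *\<^sub>R (exp (- (s * x)) *\<^sub>R I (x - d))" for x
      using d I_neg[of "x - d"] by (cases "d \<le> x") (auto simp: g_def mult_exp_exp algebra_simps)
    have "has_bochner_integral lborel (\<lambda>x. g (- d + 1 * x)) ((h /\<^sub>R s) /\<^sub>R \<bar>1\<bar>)"
      using I unfolding L_def g_def[symmetric]
      by (subst (asm) lborel_has_bochner_integral_real_affine_iff[of 1 _ _ "- d"]) simp_all
    then have "has_bochner_integral lborel (\<lambda>x. exp (- (d * s)) *\<^sub>R g (- d + 1 * x)) (exp (- (d * s)) *\<^sub>R ((h /\<^sub>R s) /\<^sub>R \<bar>1\<bar>))"
      by (rule has_bochner_integral_scaleR_right)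
    then have I_shift: "L s (\<lambda>x. I (x - d)) (exp (- (d * s)) *\<^sub>R (h /\<^sub>R s))"
      unfolding g_shift L_def by simp
    have lin: "L s (\<lambda>x. g (f x)) (g v)" if "bounded_linear g" "L s f v" for g f v
      using has_bochner_integral_bounded_linear[OF that(1) that(2)[unfolded L_def]]
      by (simp add: L_def linear_scale[OF bounded_linear.linear[OF that(1)]])
    have p: "L s (\<lambda>_. p) (p /\<^sub>R s)"
      using has_bochner_integral_scaleR_left[OF has_bochner_integral_exp_atLeast_0[OF \<open>0 < s\<close>], of p]
      by (simp add: L_def divide_inverse)
    have add: "L s (\<lambda>x. f x + g x) (u + v)" if "L s f u" "L s g v" for f g u v
      using has_bochner_integral_add that by (fastforce simp: L_def scaleR_add_right)
    have diff: "L s (\<lambda>x. f x - g x) (u - v)" if "L s f u" "L s g v" for f g u v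
      using has_bochner_integral_diff that by (fastforce simp: L_def scaleR_diff_right)
    have "L s V (r *\<^sub>R h + A *v (h /\<^sub>R s) + (\<nu> \<bullet> (exp (- (d * s)) *\<^sub>R (h /\<^sub>R s))) *\<^sub>R t - p /\<^sub>R s)"
      unfolding V_def by (intro add diff lin[of "(*\<^sub>R) r"] lin[of "(*v) A"] lin[of "\<lambda>v. (\<nu> \<bullet> v) *\<^sub>R t"]
          bounded_linear_scaleR_right matrix_vector_mul_bounded_linear bounded_linear_scaleR_const
          bounded_linear_inner_right H I I_shift p)
    also have "r *\<^sub>R h + A *v (h /\<^sub>R s) + (\<nu> \<bullet> (exp (- (d * s)) *\<^sub>R (h /\<^sub>R s))) *\<^sub>R t - p /\<^sub>R s
        = (F s *v h - p) /\<^sub>R s"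
      using \<open>0 < s\<close> unfolding F_def
      by (simp add: matrix_vector_mult_add_rdistrib outer_mult_vector matrix_vector_mult_scaleR algebra_simps
        flip: scaleR_matrix_vector_assoc)
    finally show ?thesis
      by (simp add: Fh)
  qed
  have V_inner: "V x \<bullet> e = 0" if x: "0 \<le> x" for x e
  proof (rule laplace_transform_eq_0_imp_eq_0[OF _ _ x])
    show "continuous_on {0..} (\<lambda>x. V x \<bullet> e)"
      by (intro continuous_intros V_cont)
    show "\<forall>\<^sub>F s in at_top. set_integrable lborel {0..} (\<lambda>x. exp (- (s * x)) * (V x \<bullet> e)) \<and>
        (LINT x:{0..}|lborel. exp (- (s * x)) * (V x \<bullet> e)) = 0"
      using eventually_gt_at_top[of "max S 0"]
    proof eventually_elim
      case (elim s)
      from has_bochner_integral_inner_left[of e, OF L_V[OF elim, unfolded L_def]] show ?case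
        by (simp add: has_bochner_integral_iff set_integrable_def set_lebesgue_integral_def mult.assoc)
    qed
  qed
  have "r *\<^sub>R H x + A *v I x + (\<nu> \<bullet> I (x - d)) *\<^sub>R t = p" if "0 \<le> x" for x
  proof -
    have "V x = 0"
      using V_inner[OF that, of "V x"] by (simp only: inner_eq_zero_iff)
    then show ?thesis
      by (simp only: V_def right_minus_eq)
  qed
  then show ?thesis
    using H_cont unfolding delay_solution_def I_def H_def[abs_def] by blast
qed

text \<open>
  The derivative of \<open>exp (x T) H (y + r x)\<close> in \<open>x\<close> is \<open>- u (y + r x - d) exp (x T) t\<close>, as the terms with \<open>T H\<close> cancel; it is
  integrated from \<open>x = 0\<close>, where the path takes the value \<open>H y\<close>, to the time at which the level reaches \<open>l\<close>.
\<close>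

lemma delay_solution_variation_of_constants:
  fixes T :: "real^'n^'n" and t \<nu> p :: "real^'n" and H :: "real \<Rightarrow> real^'n"
  assumes r: "0 < r" and d: "0 < d" and sol: "delay_solution r d T t \<nu> p H"
    and y: "0 \<le> y" "y \<le> l"
  defines "u \<equiv> \<lambda>z. if z < 0 then 0 else \<nu> \<bullet> H z"
  shows "((\<lambda>x. u (y + r * x - d) *\<^sub>R (mat_exp (x *\<^sub>R T) *v t)) has_integral
    H y - mat_exp (((l - y) / r) *\<^sub>R T) *v H l) {0..(l - y) / r}"
proof -
  have H_cont: "continuous_on {0..} H"
    and eq: "\<And>x. 0 \<le> x \<Longrightarrow> r *\<^sub>R H x + T *v integral {0..x} H + (\<nu> \<bullet> integral {0..x - d} H) *\<^sub>R t = p"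
    using sol by (auto simp: delay_solution_def)
  define F where "F x = mat_exp (x *\<^sub>R T) *v H (y + r * x)" for x
  define R where "R = (l - y) / r"
  have bb: "bounded_bilinear ((*v) :: real^'n^'n \<Rightarrow> real^'n \<Rightarrow> real^'n)"
    by (rule bounded_bilinear_matrix_vector_mult)
  have H_deriv: "(H has_vector_derivative - (T *v H z + u (z - d) *\<^sub>R t) /\<^sub>R r) (at z)" if z: "0 < z" "z \<noteq> d" for z
  proof (rule has_vector_derivative_transform_within_open)
    have 1: "((\<lambda>x. integral {0..x} H) has_vector_derivative H z) (at z)"
      using primitive_has_vector_derivative[OF H_cont, of z] z by simp
    have "((\<lambda>x. integral {0..x} H) has_vector_derivative (if z - d < 0 then 0 else H (z - d))) (at (z - d))"
      using primitive_has_vector_derivative[OF H_cont, of "z - d"] z by simp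
    moreover have "((\<lambda>x. x - d) has_vector_derivative 1) (at z)"
      by (auto intro!: derivative_eq_intros)
    ultimately have 2: "((\<lambda>x. integral {0..x - d} H) has_vector_derivative (if z - d < 0 then 0 else H (z - d))) (at z)"
      using vector_diff_chain_at[of "\<lambda>x. x - d" 1 z "\<lambda>x. integral {0..x} H"] by (simp add: o_def)
    have 3: "((\<lambda>x. T *v integral {0..x} H) has_vector_derivative T *v H z) (at z)"
      by (rule bounded_linear.has_vector_derivative[OF matrix_vector_mul_bounded_linear 1])
    have lin: "bounded_linear (\<lambda>v. (\<nu> \<bullet> v) *\<^sub>R t)"
      by (intro bounded_linear_scaleR_const bounded_linear_inner_right)
    have 4: "((\<lambda>x. (\<nu> \<bullet> integral {0..x - d} H) *\<^sub>R t) has_vector_derivative u (z - d) *\<^sub>R t) (at z)"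
      using bounded_linear.has_vector_derivative[OF lin 2] by (auto simp: u_def split: if_splits)
    have "((\<lambda>x. p - (T *v integral {0..x} H + (\<nu> \<bullet> integral {0..x - d} H) *\<^sub>R t)) has_vector_derivative
        0 - (T *v H z + u (z - d) *\<^sub>R t)) (at z)"
      by (intro has_vector_derivative_diff has_vector_derivative_const has_vector_derivative_add 3 4)
    from bounded_linear.has_vector_derivative[OF bounded_linear_scaleR_right[of "inverse r"] this]
    show "((\<lambda>x. (p - (T *v integral {0..x} H + (\<nu> \<bullet> integral {0..x - d} H) *\<^sub>R t)) /\<^sub>R r) has_vector_derivative
        - (T *v H z + u (z - d) *\<^sub>R t) /\<^sub>R r) (at z)"
      by simp
    show "open {0::real<..}" "z \<in> {0<..}"
      using z by auto
    fix x :: real assume "x \<in> {0<..}"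
    then have "p - (T *v integral {0..x} H + (\<nu> \<bullet> integral {0..x - d} H) *\<^sub>R t) = r *\<^sub>R H x"
      using eq[of x] by (simp add: algebra_simps)
    then show "(p - (T *v integral {0..x} H + (\<nu> \<bullet> integral {0..x - d} H) *\<^sub>R t)) /\<^sub>R r = H x"
      using r by simp
  qed
  have "((\<lambda>x. - u (y + r * x - d) *\<^sub>R (mat_exp (x *\<^sub>R T) *v t)) has_integral F R - F 0) {0..R}"
  \<comment> \<open>The exceptional point is where \<open>y + r x\<close> passes the kink of \<open>H\<close> at \<open>d\<close>.\<close>
  proof (rule fundamental_theorem_of_calculus_interior_strong[of "{(d - y) / r}"])
    show "0 \<le> R"
      using y r by (simp add: R_def)
    show "continuous_on {0..R} F"
      unfolding F_def
      by (intro continuous_on_matrix_vector_mult continuous_intros continuous_on_compose2[OF H_cont])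
         (use y r in auto)
    fix x assume x: "x \<in> {0<..<R} - {(d - y) / r}"
    define z where "z = y + r * x"
    have z: "0 < z" "z \<noteq> d"
      using x y r by (auto simp: z_def field_simps add_nonneg_pos)
    have "((\<lambda>x. y + r * x) has_vector_derivative r) (at x)"
      by (auto intro!: derivative_eq_intros)
    from vector_diff_chain_at[OF this H_deriv[OF z, unfolded z_def]]
    have Hz: "((\<lambda>x. H (y + r * x)) has_vector_derivative - (T *v H z + u (z - d) *\<^sub>R t)) (at x)"
      using r by (simp add: z_def o_def)
    show "(F has_vector_derivative - u (y + r * x - d) *\<^sub>R (mat_exp (x *\<^sub>R T) *v t)) (at x)"
      unfolding F_def
      by (rule has_vector_derivative_eq_rhs, 
          rule bounded_bilinear.has_vector_derivative[OF bb mat_exp_has_vector_derivative Hz])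
         (simp add: z_def bounded_bilinear.minus_right[OF bb] bounded_bilinear.diff_right[OF bb] matrix_vector_mul_assoc
            matrix_vector_right_distrib matrix_vector_mult_scaleR)
  qed simp
  from has_integral_neg[OF this] show ?thesis
    using r by (simp add: F_def R_def matrix_vector_mul_lid)
qed

text \<open>
  The case \<open>t = absorption_rates T\<close> multiplied by \<open>\<nu>\<close>, so that the phase-type density appears as the kernel.
\<close>

lemma delay_solution_renewal_equation:
  fixes T :: "real^'n^'n" and \<nu> p :: "real^'n" and H :: "real \<Rightarrow> real^'n"
  assumes "0 < r" "0 < d" "delay_solution r d T (absorption_rates T) \<nu> p H"
    and "0 \<le> y" "y \<le> l"
  defines "u \<equiv> \<lambda>z. if z < 0 then 0 else \<nu> \<bullet> H z"
  shows "((\<lambda>x. ph_density T \<nu> x * u (y + r * x - d)) has_integral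
    u y - \<nu> \<bullet> (mat_exp (((l - y) / r) *\<^sub>R T) *v H l)) {0..(l - y) / r}"
proof -
  have "((\<lambda>x. \<nu> \<bullet> (u (y + r * x - d) *\<^sub>R (mat_exp (x *\<^sub>R T) *v absorption_rates T))) has_integral
    \<nu> \<bullet> (H y - mat_exp (((l - y) / r) *\<^sub>R T) *v H l)) {0..(l - y) / r}"
    using has_integral_linear[OF delay_solution_variation_of_constants[OF assms(1-5)] bounded_linear_inner_right[of \<nu>]]
    by (simp add: u_def o_def)
  moreover have "\<nu> \<bullet> (H y - mat_exp (((l - y) / r) *\<^sub>R T) *v H l) = u y - \<nu> \<bullet> (mat_exp (((l - y) / r) *\<^sub>R T) *v H l)"
    using \<open>0 \<le> y\<close> by (simp add: u_def inner_diff_right)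
  ultimately show ?thesis
    by (rule_tac has_integral_spike_finite[of "{0}"]) (auto simp: ph_density_def)
qed

text \<open>
  At a maximum \<open>m\<close> of \<open>|u|\<close> on \<open>[0, l]\<close>, the renewal equation bounds \<open>|u m|\<close> by itself times the probability that a life time is at
  most \<open>R\<close>, which is less than 1. Hence \<open>u = 0\<close>, the variation-of-constants formula gives \<open>H 0 = 0\<close>, and \<open>p = r H 0\<close>.
\<close>

lemma delay_solution_zero_at_end:
  fixes T :: "real^'n^'n" and \<nu> p :: "real^'n" and H :: "real \<Rightarrow> real^'n"
  assumes ph: "phase_type T \<nu>" and r: "0 < r" and d: "0 < d" and sol: "delay_solution r d T (absorption_rates T) \<nu> p H"
    and l: "0 \<le> l" "H l = 0"
  shows "p = 0"
proof -
  have H_cont: "continuous_on {0..} H"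
    using sol by (simp add: delay_solution_def)
  define u where "u = (\<lambda>z. if z < 0 then 0 else \<nu> \<bullet> H z)"
  have u_cont: "continuous_on {0..l} (\<lambda>z. \<bar>\<nu> \<bullet> H z\<bar>)"
    by (intro continuous_intros continuous_on_subset[OF H_cont]) auto
  obtain m where m: "0 \<le> m" "m \<le> l" "\<And>z. 0 \<le> z \<Longrightarrow> z \<le> l \<Longrightarrow> \<bar>\<nu> \<bullet> H z\<bar> \<le> \<bar>\<nu> \<bullet> H m\<bar>"
    using continuous_attains_sup[OF compact_Icc _ u_cont] l by fastforce
  have u_le: "\<bar>u z\<bar> \<le> \<bar>u m\<bar>" if "z \<le> l" for z
    using m that by (simp add: u_def)
  define R where "R = (l - m) / r"
  have R: "0 \<le> R"
    using m r by (simp add: R_def)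
  define S where "S = \<nu> \<bullet> (mat_exp (R *\<^sub>R T) *v 1)"
  have "((\<lambda>x. ph_density T \<nu> x * u (m + r * x - d)) has_integral u m) {0..R}"
    using delay_solution_renewal_equation[OF r d sol m(1,2)] l by (simp add: u_def R_def)
  moreover have mass: "(ph_density T \<nu> has_integral 1 - S) {0..R}"
    using ph_density_has_integral[OF ph, of 0 1 R] R ph_initial(2)[OF ph]
    by (simp add: S_def absorption_rates_def inner_vec_def)
  ultimately have "\<bar>u m\<bar> \<le> (1 - S) * \<bar>u m\<bar>"
  proof -
    assume u: "((\<lambda>x. ph_density T \<nu> x * u (m + r * x - d)) has_integral u m) {0..R}"
    have "norm (integral {0..R} (\<lambda>x. ph_density T \<nu> x * u (m + r * x - d))) \<le> integral {0..R} (\<lambda>x. ph_density T \<nu> x * \<bar>u m\<bar>)"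
    proof (rule integral_norm_bound_integral)
      fix x assume "x \<in> {0..R}"
      then have "m + r * x - d \<le> l"
        using d r by (simp add: R_def field_simps)
      then show "norm (ph_density T \<nu> x * u (m + r * x - d)) \<le> ph_density T \<nu> x * \<bar>u m\<bar>"
        using u_le ph_density_nonneg[OF ph] by (simp add: abs_mult mult_left_mono)
    qed (use u has_integral_mult_left[OF mass, of "\<bar>u m\<bar>"] in \<open>auto simp: has_integral_integrable\<close>)
    then show ?thesis
      by (simp add: integral_unique[OF u] integral_unique[OF mass])
  qed
  then have "S * \<bar>u m\<bar> \<le> 0"
    by (simp add: algebra_simps)
  moreover have "0 < S"
    unfolding S_def by (rule survival_pos[OF ph R])
  ultimately have "u m = 0"
    by (simp add: mult_le_0_iff)
  then have u_zero: "u z = 0" if "z \<le> l" for z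
    using u_le[OF that] by simp
  have "((\<lambda>x. u (0 + r * x - d) *\<^sub>R (mat_exp (x *\<^sub>R T) *v absorption_rates T)) has_integral
      H 0 - mat_exp (((l - 0) / r) *\<^sub>R T) *v H l) {0..(l - 0) / r}"
    unfolding u_def using l by (intro delay_solution_variation_of_constants[OF r d sol]) auto
  moreover have "((\<lambda>x. u (0 + r * x - d) *\<^sub>R (mat_exp (x *\<^sub>R T) *v absorption_rates T)) has_integral 0) {0..(l - 0) / r}"
  proof (rule has_integral_is_0)
    fix x assume "x \<in> {0..(l - 0) / r}"
    then have "r * x \<le> l"
      using r by (simp add: pos_le_divide_eq mult.commute)
    then have "u (0 + r * x - d) = 0"
      using d by (intro u_zero) simp
    then show "u (0 + r * x - d) *\<^sub>R (mat_exp (x *\<^sub>R T) *v absorption_rates T) = 0"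
      by simp
  qed
  ultimately have "H 0 = 0"
    using l by (auto dest: has_integral_unique)
  moreover have "r *\<^sub>R H 0 + T *v integral {0..0} H + (\<nu> \<bullet> integral {0..0 - d} H) *\<^sub>R absorption_rates T = p"
    using sol unfolding delay_solution_def by blast
  moreover have "{0..0 - d} = {}"
    using d by simp
  ultimately show "p = 0"
    by simp
qed

section \<open>Exit probabilities of a random walk\<close>

text \<open>
  Stopping the walk at its exit, instead of recording the exit time, keeps its position after
  \<open>k\<close> steps a measurable function of the first \<open>k\<close> steps. Steps are numbered from 1.
\<close>

primrec stopped_walk :: "real \<Rightarrow> real \<Rightarrow> (nat \<Rightarrow> real) \<Rightarrow> nat \<Rightarrow> real" where
  "stopped_walk a b x 0 = 0"
| "stopped_walk a b x (Suc k) =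
    (if a < stopped_walk a b x k \<and> stopped_walk a b x k < b
     then stopped_walk a b x k + x (Suc k) else stopped_walk a b x k)"

lemma stopped_walk_cong:
  "(\<And>i. 1 \<le> i \<Longrightarrow> i \<le> k \<Longrightarrow> x i = y i) \<Longrightarrow> stopped_walk a b x k = stopped_walk a b y k"
  by (induction k) auto

lemma measurable_stopped_walk:
  "{1..k} \<subseteq> J \<Longrightarrow> (\<lambda>x. stopped_walk a b x k) \<in> borel_measurable (PiM J (\<lambda>_. borel))"
proof (induction k)
  case (Suc k)
  then have [measurable]: "(\<lambda>x. stopped_walk a b x k) \<in> borel_measurable (PiM J (\<lambda>_. borel))"
    by (simp add: subset_iff)
  have [measurable]: "(\<lambda>x. x (Suc k)) \<in> borel_measurable (PiM J (\<lambda>_. borel :: real measure))"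
    using Suc.prems by (intro measurable_component_singleton) auto
  show ?case by simp measurable
qed simp

lemma stopped_walk_before_exit:
  assumes "\<forall>j<k. a < (\<Sum>i=1..j. x i) \<and> (\<Sum>i=1..j. x i) < b"
  shows "stopped_walk a b x k = (\<Sum>i=1..k. x i)"
  using assms by (induction k) auto

lemma stopped_walk_after_exit:
  assumes "k \<le> n" "\<not> (a < stopped_walk a b x k \<and> stopped_walk a b x k < b)"
  shows "stopped_walk a b x n = stopped_walk a b x k"
  using assms(1)
proof (induction n rule: dec_induct)
  case (step n)
  then show ?case using assms(2) by (simp del: not_le add: if_not_P)
qed simp

lemma exit_index_eq_enat_iff:
  "exit_index a b L \<omega> = enat k \<longleftrightarrow> L k \<omega> \<notin> {a<..<b} \<and> (\<forall>j<k. L j \<omega> \<in> {a<..<b})"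
proof -
  define P where "P k \<longleftrightarrow> L k \<omega> \<notin> {a<..<b}" for k
  have Inf_eq: "exit_index a b L \<omega> = Inf (enat ` {k. P k})"
    by (simp add: exit_index_def P_def image_def) metis
  have Least: "exit_index a b L \<omega> = enat (LEAST k. P k)" if "P n" for n
    unfolding Inf_eq
  proof (rule Inf_eqI)
    show "y \<le> enat (LEAST k. P k)" if "\<And>i. i \<in> enat ` {k. P k} \<Longrightarrow> y \<le> i" for y
      using that LeastI[of P n] \<open>P n\<close> by simp
  qed (auto intro: Least_le)
  show ?thesis
  proof
    assume *: "exit_index a b L \<omega> = enat k"
    then have "\<exists>n. P n"
      by (rule_tac ccontr) (auto simp: Inf_eq top_enat_def)
    then obtain n where "P n" ..
    with Least * have "k = (LEAST k. P k)" by simp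
    then show "L k \<omega> \<notin> {a<..<b} \<and> (\<forall>j<k. L j \<omega> \<in> {a<..<b})"
      using LeastI[of P n] \<open>P n\<close> not_less_Least[of _ P] unfolding P_def by blast
  next
    assume *: "L k \<omega> \<notin> {a<..<b} \<and> (\<forall>j<k. L j \<omega> \<in> {a<..<b})"
    then have "(LEAST k. P k) = k"
      by (intro Least_equality) (auto simp: P_def not_less[symmetric])
    then show "exit_index a b L \<omega> = enat k"
      using Least[of k] * by (simp add: P_def)
  qed
qed

text \<open>
  The stopped walk reaches the outside of \<open>(a, b)\<close> only at the exit position and stays there.
\<close>

lemma exit_iff_stopped_walk:
  assumes L: "\<And>k. L k \<omega> = (\<Sum>i=1..k. x i)" and C: "C \<inter> {a<..<b} = {}"
  shows "(\<exists>k. exit_index a b L \<omega> = enat k \<and> L k \<omega> \<in> C) \<longleftrightarrow> (\<exists>k. stopped_walk a b x k \<in> C)"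
proof
  assume "\<exists>k. exit_index a b L \<omega> = enat k \<and> L k \<omega> \<in> C"
  then obtain k where "\<forall>j<k. L j \<omega> \<in> {a<..<b}" "L k \<omega> \<in> C"
    by (auto simp: exit_index_eq_enat_iff)
  then show "\<exists>k. stopped_walk a b x k \<in> C"
    using stopped_walk_before_exit[of k a x b] by (metis L greaterThanLessThan_iff)
next
  assume "\<exists>k. stopped_walk a b x k \<in> C"
  then obtain n where n: "stopped_walk a b x n \<in> C" ..
  have "\<exists>k. L k \<omega> \<notin> {a<..<b}"
  proof (rule ccontr)
    assume "\<nexists>k. L k \<omega> \<notin> {a<..<b}"
    then have "stopped_walk a b x n = L n \<omega>" "L n \<omega> \<in> {a<..<b}"
      using stopped_walk_before_exit[of n a x b] by (auto simp: L)
    then show False using n C by auto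
  qed
  then obtain k where k: "L k \<omega> \<notin> {a<..<b}" "\<forall>j<k. L j \<omega> \<in> {a<..<b}"
    using exists_least_iff[of "\<lambda>k. L k \<omega> \<notin> {a<..<b}"] by auto
  have before: "stopped_walk a b x j = L j \<omega>" if "j \<le> k" for j
    using k(2) that stopped_walk_before_exit[of j a x b] by (auto simp: L)
  have "k \<le> n"
    using before[of n] k(2) n C by (metis disjoint_iff not_le order.strict_implies_order)
  then have "stopped_walk a b x n = L k \<omega>"
    using stopped_walk_after_exit[of k n a b x] before[of k] k(1) by auto
  then show "\<exists>k. exit_index a b L \<omega> = enat k \<and> L k \<omega> \<in> C"
    using k n by (auto simp: exit_index_eq_enat_iff)
qed

lemma (in prob_space) expectation_indep_pair:
  fixes G :: "'b \<times> 'b \<Rightarrow> real"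
  assumes indep: "indep_var S Z T X"
    and G[measurable]: "G \<in> borel_measurable (S \<Otimes>\<^sub>M T)" and bound: "\<And>p. \<bar>G p\<bar> \<le> B"
  shows "expectation (\<lambda>\<omega>. G (Z \<omega>, X \<omega>)) = expectation (\<lambda>\<omega>. \<integral>x. G (Z \<omega>, x) \<partial>distr M T X)"
proof -
  have [measurable]: "Z \<in> measurable M S" "X \<in> measurable M T"
    using indep by (auto simp: indep_var_distribution_eq)
  interpret Z: prob_space "distr M S Z" by (rule prob_space_distr) simp
  interpret X: prob_space "distr M T X" by (rule prob_space_distr) simp
  interpret P: pair_prob_space "distr M S Z" "distr M T X" ..
  have "expectation (\<lambda>\<omega>. G (Z \<omega>, X \<omega>)) = (\<integral>p. G p \<partial>distr M (S \<Otimes>\<^sub>M T) (\<lambda>\<omega>. (Z \<omega>, X \<omega>)))"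
    by (subst integral_distr) auto
  also have "\<dots> = (\<integral>p. G p \<partial>(distr M S Z \<Otimes>\<^sub>M distr M T X))"
    using indep by (simp add: indep_var_distribution_eq)
  also have "\<dots> = (\<integral>z. \<integral>x. G (z, x) \<partial>distr M T X \<partial>distr M S Z)"
    by (rule P.integral_fst'[symmetric], rule P.P.integrable_const_bound[where B=B]) (auto simp: bound)
  also have "\<dots> = expectation (\<lambda>\<omega>. \<integral>x. G (Z \<omega>, x) \<partial>distr M T X)"
    by (subst integral_distr) auto
  finally show ?thesis .
qed

text \<open>
  The mean of \<open>h\<close> along the stopped walk \<open>Z\<close> is constantly \<open>h 0\<close>: the next step is independent of the past, and \<open>h\<close> is
  harmonic inside \<open>(a, b)\<close>. A step of size at least \<open>b - a\<close> leaves the interval from any of its points, so the probability of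
  being still inside decays geometrically. In the limit the mean of \<open>h\<close> is the probability of having left through \<open>b\<close>.
\<close>

lemma (in prob_space) random_walk_exit_probability:
  fixes X :: "nat \<Rightarrow> 'a \<Rightarrow> real"
  assumes indep: "indep_vars (\<lambda>_. borel) X {1..}"
    and law: "\<And>i. 1 \<le> i \<Longrightarrow> distr M borel (X i) = D"
    and ab: "a < 0" "0 < b"
    and h_meas [measurable]: "h \<in> borel_measurable borel" and h_bound: "\<And>z. \<bar>h z\<bar> \<le> B"
    and h_above: "\<And>z. b \<le> z \<Longrightarrow> h z = 1" and h_below: "\<And>z. z \<le> a \<Longrightarrow> h z = 0"
    and harmonic: "\<And>z. a < z \<Longrightarrow> z < b \<Longrightarrow> (\<integral>x. h (z + x) \<partial>D) = h z"
    and big_step: "0 < measure D {b - a..}"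
  shows "prob {\<omega> \<in> space M. \<exists>k. stopped_walk a b (\<lambda>i. X i \<omega>) k \<in> {b..}} = h 0"
    and "prob {\<omega> \<in> space M. \<exists>k. stopped_walk a b (\<lambda>i. X i \<omega>) k \<in> {..a}} = 1 - h 0"
proof -
  define Z where "Z k \<omega> = stopped_walk a b (\<lambda>i. X i \<omega>) k" for k \<omega>
  define Up where "Up k = {\<omega> \<in> space M. b \<le> Z k \<omega>}" for k
  define In where "In k = {\<omega> \<in> space M. a < Z k \<omega> \<and> Z k \<omega> < b}" for k
  define Down where "Down k = {\<omega> \<in> space M. Z k \<omega> \<le> a}" for k
  have X_meas [measurable]: "X i \<in> borel_measurable M" if "1 \<le> i" for i
    using indep that by (auto simp: indep_vars_def)
  have indep_Z: "indep_var borel (Z k) borel (X (Suc k))" for k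
  proof -
    have "indep_var (PiM {1..k} (\<lambda>_. borel)) (\<lambda>\<omega>. restrict (\<lambda>i. X i \<omega>) {1..k})
        (PiM {Suc k} (\<lambda>_. borel)) (\<lambda>\<omega>. restrict (\<lambda>i. X i \<omega>) {Suc k})"
      by (rule indep_var_restrict[OF indep]) auto
    then have "indep_var borel ((\<lambda>x. stopped_walk a b x k) \<circ> (\<lambda>\<omega>. restrict (\<lambda>i. X i \<omega>) {1..k}))
        borel ((\<lambda>x. x (Suc k)) \<circ> (\<lambda>\<omega>. restrict (\<lambda>i. X i \<omega>) {Suc k}))"
      by (rule indep_var_compose) (auto intro!: measurable_stopped_walk)
    moreover have "(\<lambda>x. stopped_walk a b x k) \<circ> (\<lambda>\<omega>. restrict (\<lambda>i. X i \<omega>) {1..k}) = Z k"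
      by (auto simp: Z_def fun_eq_iff intro!: stopped_walk_cong)
    moreover have "(\<lambda>x. x (Suc k)) \<circ> (\<lambda>\<omega>. restrict (\<lambda>i. X i \<omega>) {Suc k}) = X (Suc k)"
      by auto
    ultimately show ?thesis by metis
  qed
  then have Z_meas [measurable]: "Z k \<in> borel_measurable M" for k
    by (auto simp: indep_var_distribution_eq)
  have D: "prob_space D" "sets D = sets borel"
    using law[of 1] prob_space_distr[OF X_meas[of 1]] by auto
  interpret D: prob_space D by fact
  have sets [measurable]: "Up k \<in> events" "In k \<in> events" "Down k \<in> events" for k
    unfolding Up_def In_def Down_def by measurable

  have h_int: "integrable M (\<lambda>\<omega>. h (Z k \<omega>))" for k
    by (rule integrable_const_bound[where B=B]) (auto simp: h_bound)
  have mean: "expectation (\<lambda>\<omega>. h (Z k \<omega>)) = h 0" for k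
  proof (induction k)
    case 0
    show ?case by (simp add: Z_def prob_space)
  next
    case (Suc k)
    define G where "G p = h (if a < fst p \<and> fst p < b then fst p + snd p else fst p)" for p
    have "expectation (\<lambda>\<omega>. h (Z (Suc k) \<omega>)) = expectation (\<lambda>\<omega>. G (Z k \<omega>, X (Suc k) \<omega>))"
      by (rule arg_cong[of _ _ "expectation"]) (auto simp: G_def Z_def fun_eq_iff)
    also have "\<dots> = expectation (\<lambda>\<omega>. \<integral>x. G (Z k \<omega>, x) \<partial>distr M borel (X (Suc k)))"
      by (rule expectation_indep_pair[OF indep_Z, where B=B]) (auto simp: G_def h_bound)
    also have "\<dots> = expectation (\<lambda>\<omega>. h (Z k \<omega>))"
    proof (intro Bochner_Integration.integral_cong refl)
      fix \<omega>
      show "(\<integral>x. G (Z k \<omega>, x) \<partial>distr M borel (X (Suc k))) = h (Z k \<omega>)"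
        using harmonic[of "Z k \<omega>"] D.prob_space
        by (cases "a < Z k \<omega> \<and> Z k \<omega> < b") (simp_all add: G_def law if_not_P del: de_Morgan_conj)
    qed
    finally show ?case using Suc by simp
  qed

  define \<rho> where "\<rho> = 1 - measure D {b - a..}"
  have \<rho>: "0 \<le> \<rho>" "\<rho> < 1"
    using big_step D.prob_le_1 by (auto simp: \<rho>_def)
  have step_small: "prob {\<omega> \<in> space M. X (Suc k) \<omega> < b - a} = \<rho>" for k
  proof -
    have "prob {\<omega> \<in> space M. X (Suc k) \<omega> < b - a} = measure (distr M borel (X (Suc k))) {..<b - a}"
      by (subst measure_distr) (auto intro!: arg_cong[of _ _ prob])
    also have "\<dots> = measure D (space D - {b - a..})"
      using sets_eq_imp_space_eq[OF D(2)] by (auto simp: law intro!: arg_cong[of _ _ "measure D"])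
    also have "\<dots> = \<rho>"
      unfolding \<rho>_def by (rule D.prob_compl) (simp add: D(2))
    finally show ?thesis .
  qed
  have In_bound: "prob (In k) \<le> \<rho> ^ k" for k
  proof (induction k)
    case (Suc k)
    have "prob (In (Suc k)) \<le> prob (Z k -` {a<..<b} \<inter> space M \<inter> (X (Suc k) -` {..<b - a} \<inter> space M))"
      by (rule finite_measure_mono) (auto simp: In_def Z_def split: if_splits)
    also have "\<dots> = prob (In k) * prob {\<omega> \<in> space M. X (Suc k) \<omega> < b - a}"
      using indep_varD[OF indep_Z, of "{a<..<b}" "{..<b - a}" k]
      by (simp add: In_def vimage_def Int_def conj_ac)
    also have "\<dots> \<le> \<rho> ^ k * \<rho>"
      using Suc \<rho> by (simp add: step_small mult_right_mono)
    finally show ?case by (simp add: mult.commute)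
  qed simp
  have In_tendsto: "(\<lambda>k. prob (In k)) \<longlonglongrightarrow> 0"
    by (rule tendsto_sandwich[OF _ _ tendsto_const LIMSEQ_realpow_zero[OF \<rho>]]) (auto simp: In_bound)

  have Up_tendsto: "(\<lambda>k. prob (Up k)) \<longlonglongrightarrow> h 0"
  proof -
    have "\<bar>h 0 - prob (Up k)\<bar> \<le> B * prob (In k)" for k
    proof -
      have Up_int: "integrable M (\<lambda>\<omega>. indicator (Up k) \<omega> :: real)"
        and In_int: "integrable M (\<lambda>\<omega>. B * indicator (In k) \<omega>)"
        by (auto intro!: integrable_const_bound[where B=1] integrable_mult_right)
      have le: "\<bar>h (Z k \<omega>) - indicator (Up k) \<omega>\<bar> \<le> B * indicator (In k) \<omega>" if "\<omega> \<in> space M" for \<omega>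
        using that h_above[of "Z k \<omega>"] h_below[of "Z k \<omega>"] h_bound[of "Z k \<omega>"] ab
        by (cases "Z k \<omega> \<le> a"; cases "b \<le> Z k \<omega>") (auto simp: Up_def In_def)
      have "h 0 - prob (Up k) = expectation (\<lambda>\<omega>. h (Z k \<omega>) - indicator (Up k) \<omega>)"
        using Up_int h_int mean by simp
      also have "\<bar>\<dots>\<bar> \<le> expectation (\<lambda>\<omega>. \<bar>h (Z k \<omega>) - indicator (Up k) \<omega>\<bar>)"
        by (rule integral_abs_bound)
      also have "\<dots> \<le> expectation (\<lambda>\<omega>. B * indicator (In k) \<omega>)"
        using le Up_int In_int h_int by (intro integral_mono) auto
      finally show ?thesis by simp
    qed
    then have "(\<lambda>k. h 0 - prob (Up k)) \<longlonglongrightarrow> 0"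
      by (intro Lim_null_comparison[OF _ tendsto_mult_right_zero[OF In_tendsto, of B]]) auto
    from tendsto_diff[OF tendsto_const[of "h 0"] this] show ?thesis by simp
  qed
  have "prob (Down k) = 1 - prob (Up k) - prob (In k)" for k
  proof -
    have "prob (space M) = prob (Down k \<union> (Up k \<union> In k))"
      by (rule arg_cong[of _ _ prob]) (auto simp: Up_def In_def Down_def)
    also have "\<dots> = prob (Down k) + prob (Up k \<union> In k)"
      using ab by (intro finite_measure_Union) (auto simp: Up_def In_def Down_def)
    also have "prob (Up k \<union> In k) = prob (Up k) + prob (In k)"
      by (intro finite_measure_Union) (auto simp: Up_def In_def)
    finally show ?thesis by (simp add: prob_space)
  qed
  then have Down_tendsto: "(\<lambda>k. prob (Down k)) \<longlonglongrightarrow> 1 - h 0"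
    using tendsto_diff[OF tendsto_diff[OF tendsto_const[of 1] Up_tendsto] In_tendsto] by simp

  have Z_stays: "Z (Suc k) \<omega> = Z k \<omega>" if "\<not> (a < Z k \<omega> \<and> Z k \<omega> < b)" for k \<omega>
    using that by (auto simp: Z_def)
  have "incseq Up"
    using Z_stays by (intro incseq_SucI) (auto simp: Up_def)
  then have "(\<lambda>k. prob (Up k)) \<longlonglongrightarrow> prob (\<Union>k. Up k)"
    by (intro finite_Lim_measure_incseq) auto
  then have "prob (\<Union>k. Up k) = h 0"
    using Up_tendsto by (rule LIMSEQ_unique)
  also have "(\<Union>k. Up k) = {\<omega> \<in> space M. \<exists>k. stopped_walk a b (\<lambda>i. X i \<omega>) k \<in> {b..}}"
    by (auto simp: Up_def Z_def)
  finally show "prob {\<omega> \<in> space M. \<exists>k. stopped_walk a b (\<lambda>i. X i \<omega>) k \<in> {b..}} = h 0" .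
  have "incseq Down"
    using Z_stays by (intro incseq_SucI) (auto simp: Down_def)
  then have "(\<lambda>k. prob (Down k)) \<longlonglongrightarrow> prob (\<Union>k. Down k)"
    by (intro finite_Lim_measure_incseq) auto
  then have "prob (\<Union>k. Down k) = 1 - h 0"
    using Down_tendsto by (rule LIMSEQ_unique)
  also have "(\<Union>k. Down k) = {\<omega> \<in> space M. \<exists>k. stopped_walk a b (\<lambda>i. X i \<omega>) k \<in> {..a}}"
    by (auto simp: Down_def Z_def)
  finally show "prob {\<omega> \<in> space M. \<exists>k. stopped_walk a b (\<lambda>i. X i \<omega>) k \<in> {..a}} = 1 - h 0" .
qed

section \<open>The error probabilities of the Wald test\<close>

lemma laplace_between_0_1:
  assumes int: "integrable lborel f" "(LINT x|lborel. f x) = 1"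
    and nonneg: "\<And>x. 0 \<le> f x" and zero: "\<And>x. x \<le> 0 \<Longrightarrow> f x = 0" and r: "0 < r"
  shows "0 < laplace f r" "laplace f r < 1"
proof -
  have [measurable]: "f \<in> borel_measurable borel"
    using borel_measurable_integrable[OF int(1)] by simp
  have f_nz: "\<not> (AE x in lborel. f x = 0)"
  proof
    assume "AE x in lborel. f x = 0"
    then have "(LINT x|lborel. f x) = 0"
      by (rule integral_eq_zero_AE)
    then show False using int by simp
  qed
  define k where "k x = exp (- (r * x)) * f x" for x
  have k_bounds: "0 \<le> k x" "k x \<le> f x" for x
  proof -
    show "0 \<le> k x" using nonneg by (simp add: k_def)
    show "k x \<le> f x"
      using nonneg[of x] zero[of x] r by (cases "0 < x") (simp_all add: k_def mult_left_le_one_le)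
  qed
  have k_int: "integrable lborel k"
  proof (rule Bochner_Integration.integrable_bound[OF int(1)])
    show "k \<in> borel_measurable lborel"
      unfolding k_def[abs_def] by measurable
  qed (use k_bounds nonneg in auto)
  have laplace: "laplace f r = (LINT x|lborel. k x)"
    unfolding laplace_def set_lebesgue_integral_def
    by (intro Bochner_Integration.integral_cong refl) (auto simp: k_def indicator_def zero)
  have "0 \<le> (LINT x|lborel. k x)"
    by (intro Bochner_Integration.integral_nonneg k_bounds)
  moreover have "(LINT x|lborel. k x) \<noteq> 0"
  proof
    assume "(LINT x|lborel. k x) = 0"
    then have "AE x in lborel. k x = 0"
      using integral_nonneg_eq_0_iff_AE[OF k_int] k_bounds(1) by simp
    then show False
      using f_nz by (simp add: k_def)
  qed
  ultimately show "0 < laplace f r"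
    by (simp add: laplace)
  have "0 \<le> (LINT x|lborel. f x - k x)"
    by (intro Bochner_Integration.integral_nonneg) (use k_bounds in auto)
  moreover have "(LINT x|lborel. f x - k x) \<noteq> 0"
  proof
    assume "(LINT x|lborel. f x - k x) = 0"
    then have "AE x in lborel. f x - k x = 0"
      using integral_nonneg_eq_0_iff_AE[of lborel "\<lambda>x. f x - k x"] k_bounds(2) k_int int(1) by auto
    then have "AE x in lborel. f x = 0"
    proof (rule AE_mp, intro AE_I2 impI)
      fix x assume "f x - k x = 0"
      then have "(1 - exp (- (r * x))) * f x = 0"
        by (simp add: k_def algebra_simps)
      then show "f x = 0"
        using zero[of x] r by (cases "0 < x") auto
    qed
    then show False using f_nz by simp
  qed
  moreover have "(LINT x|lborel. f x - k x) = 1 - laplace f r"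
    using int k_int by (simp add: laplace)
  ultimately show "laplace f r < 1"
    by linarith
qed

lemma distributed_density_integral:
  assumes "prob_space M" and dist: "distributed M lborel X (\<lambda>x. ennreal (f x))"
    and nonneg: "\<And>x. 0 \<le> f x" and [measurable]: "f \<in> borel_measurable borel"
  shows "integrable lborel f" "(LINT x|lborel. f x) = 1"
proof -
  interpret prob_space M by fact
  have X: "X \<in> measurable M lborel"
    using dist by (rule distributed_measurable)
  interpret D: prob_space "distr M lborel X"
    by (rule prob_space_distr[OF X])
  have "(\<integral>\<^sup>+x. ennreal (f x) \<partial>lborel) = ennreal 1"
    using D.emeasure_space_1 distributed_distr_eq_density[OF dist] by (simp add: emeasure_density)
  then have "has_bochner_integral lborel f 1"
    using nonneg by (intro has_bochner_integral_nn_integral) auto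
  then show "integrable lborel f" "(LINT x|lborel. f x) = 1"
    by (simp_all add: has_bochner_integral_iff)
qed

text \<open>
  Otherwise the whole mass 1 would lie on \<open>[0, R]\<close>, although the mass there is 1 minus a positive survival probability.
\<close>

lemma ph_density_tail_pos:
  assumes ph: "phase_type T \<nu>" and int: "integrable lborel (ph_density T \<nu>)" "(LINT x|lborel. ph_density T \<nu> x) = 1"
  shows "\<not> (AE x in lborel. K \<le> x \<longrightarrow> ph_density T \<nu> x = 0)"
proof
  assume ae: "AE x in lborel. K \<le> x \<longrightarrow> ph_density T \<nu> x = 0"
  define R where "R = max 0 K"
  note [measurable] = ph_density_measurable[OF ph]
  have part: "set_integrable lborel {0..R} (ph_density T \<nu>)"
    using int(1) unfolding set_integrable_def by (intro integrable_mult_indicator) auto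
  have "(LINT x|lborel. ph_density T \<nu> x) = (LINT x:{0..R}|lborel. ph_density T \<nu> x)"
    unfolding set_lebesgue_integral_def
  proof (rule integral_cong_AE)
    show "AE x in lborel. ph_density T \<nu> x = indicator {0..R} x *\<^sub>R ph_density T \<nu> x"
      using ae by eventually_elim (auto simp: R_def indicator_def ph_density_def)
  qed auto
  also have "\<dots> = integral {0..R} (ph_density T \<nu>)"
    by (rule set_borel_integral_eq_integral(2)[OF part])
  also have "\<dots> = 1 - \<nu> \<bullet> (mat_exp (R *\<^sub>R T) *v 1)"
    using ph_density_has_integral[OF ph, of 0 1 R] ph_initial(2)[OF ph]
    by (intro integral_unique) (simp add: R_def absorption_rates_def inner_vec_def)
  also have "\<dots> < 1"
    using survival_pos[OF ph, of R] by (simp add: R_def)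
  finally show False
    using int by simp
qed

text \<open>
  From \<open>z\<close>, a step takes the walk to \<open>b\<close> or beyond iff the observation is at least \<open>R = (b + d - z) / r\<close>. Multiplied by
  \<open>exp (\<kappa> (z - b))\<close>, the renewal equation at \<open>z - a\<close> becomes the integral over \<open>[0, R]\<close> of \<open>g\<close> times \<open>h\<close> after the step, plus a
  boundary term. The conditions on \<open>v\<close> are those that make this boundary term the mass of \<open>g\<close> beyond \<open>R\<close>, where \<open>h = 1\<close>.
\<close>

lemma scale_function_harmonic:
  fixes T :: "real^'n^'n" and \<nu> p v :: "real^'n" and H :: "real \<Rightarrow> real^'n"
  assumes ph: "phase_type T \<nu>" and r: "0 < r" and d: "0 < d" and sol: "delay_solution r d T (absorption_rates T) \<nu> p H"
    and ab: "a < b" and H_end: "H (b + d - a) = v"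
    and v: "(\<kappa> * r) *\<^sub>R v - T *v v = absorption_rates T"
    and mass: "exp (\<kappa> * d) * (\<nu> \<bullet> v) = 1"
  defines "g \<equiv> \<lambda>x. exp (\<kappa> * (d - r * x)) * ph_density T \<nu> x"
  defines "h \<equiv> \<lambda>z. if b \<le> z then 1 else if z \<le> a then 0 else exp (\<kappa> * (z - b)) * (\<nu> \<bullet> H (z - a))"
  assumes g_int: "integrable lborel g" "(LINT x|lborel. g x) = 1" 
  shows "h \<in> borel_measurable borel"
    and "\<exists>B. \<forall>z. \<bar>h z\<bar> \<le> B"
    and "\<And>z. a < z \<Longrightarrow> z < b \<Longrightarrow> (LINT x|lborel. g x * h (z + (r * x - d))) = h z"
proof -
  have H_cont: "continuous_on {0..} H"
    using sol by (simp add: delay_solution_def)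
  have mid_cont: "continuous_on {a..b} (\<lambda>z. exp (\<kappa> * (z - b)) * (\<nu> \<bullet> H (z - a)))"
    by (intro continuous_intros continuous_on_compose2[OF H_cont]) auto
  show [measurable]: "h \<in> borel_measurable borel"
  proof -
    have [measurable]: "(\<lambda>z. indicator {a..b} z *\<^sub>R (exp (\<kappa> * (z - b)) * (\<nu> \<bullet> H (z - a)))) \<in> borel_measurable borel"
      by (rule borel_measurable_continuous_on_indicator[OF _ mid_cont]) simp
    have "h = (\<lambda>z. if b \<le> z then 1 else if z \<le> a then 0 else
        indicator {a..b} z *\<^sub>R (exp (\<kappa> * (z - b)) * (\<nu> \<bullet> H (z - a))))"
      by (auto simp: h_def fun_eq_iff)
    then show ?thesis by simp
  qed
  obtain B where B: "\<And>z. z \<in> {a..b} \<Longrightarrow> \<bar>exp (\<kappa> * (z - b)) * (\<nu> \<bullet> H (z - a))\<bar> \<le> B"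
    using compact_imp_bounded[OF compact_continuous_image[OF mid_cont compact_Icc]]
    by (fastforce simp: bounded_iff)
  have h_bound: "\<bar>h z\<bar> \<le> max 1 B" for z
    using B[of z] by (auto simp: h_def)
  then show "\<exists>B. \<forall>z. \<bar>h z\<bar> \<le> B" by blast
  fix z assume z: "a < z" "z < b"
  define u where "u = (\<lambda>y. if y < 0 then 0 else \<nu> \<bullet> H y)"
  define R where "R = (b + d - z) / r"
  have R: "0 \<le> R"
    using z d r by (simp add: R_def)
  define tail where "tail = \<nu> \<bullet> (mat_exp (R *\<^sub>R T) *v v)"
  have expo: "exp (\<kappa> * d) * exp (- (\<kappa> * r * R)) = exp (\<kappa> * (z - b))"
  proof -
    have "\<kappa> * r * R = \<kappa> * (b + d - z)"
      using r by (simp add: R_def)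
    then show ?thesis
      by (simp add: mult_exp_exp algebra_simps)
  qed
  have g_part: "(g has_integral 1 - exp (\<kappa> * (z - b)) * tail) {0..R}"
  proof -
    have "((\<lambda>x. exp (\<kappa> * d) * (exp (- (\<kappa> * r * x)) * ph_density T \<nu> x)) has_integral
        exp (\<kappa> * d) * (\<nu> \<bullet> v - exp (- (\<kappa> * r * R)) * tail)) {0..R}"
      unfolding tail_def by (intro has_integral_mult_right ph_density_has_integral[OF ph v R])
    also have "(\<lambda>x. exp (\<kappa> * d) * (exp (- (\<kappa> * r * x)) * ph_density T \<nu> x)) = g"
    proof
      fix x
      have "exp (\<kappa> * (d - r * x)) = exp (\<kappa> * d) * exp (- (\<kappa> * r * x))"
        by (simp add: mult_exp_exp algebra_simps)
      then show "exp (\<kappa> * d) * (exp (- (\<kappa> * r * x)) * ph_density T \<nu> x) = g x"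
        by (simp add: g_def)
    qed
    also have "exp (\<kappa> * d) * (\<nu> \<bullet> v - exp (- (\<kappa> * r * R)) * tail) = 1 - exp (\<kappa> * (z - b)) * tail"
      using mass expo by (simp add: right_diff_distrib flip: mult.assoc)
    finally show ?thesis .
  qed
  have u_part: "((\<lambda>x. ph_density T \<nu> x * u (z - a + r * x - d)) has_integral u (z - a) - tail) {0..R}"
  proof -
    have "(b + d - a - (z - a)) / r = R"
      by (simp add: R_def)
    then show ?thesis
      using delay_solution_renewal_equation[OF r d sol, of "z - a" "b + d - a"] z d
      unfolding u_def tail_def H_end by simp
  qed
  have "((\<lambda>x. g x * h (z + (r * x - d))) has_integral exp (\<kappa> * (z - b)) * (u (z - a) - tail)) {0..R}"
  proof (rule has_integral_spike_finite[OF _ _ has_integral_mult_right[OF u_part]])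
    \<comment> \<open>At these points the walk lands on \<open>b\<close> or on \<open>a\<close>, where \<open>h\<close> and the weighted \<open>u\<close> may differ.\<close>
    show "finite {R, (a + d - z) / r}" by simp
    fix x assume x: "x \<in> {0..R} - {R, (a + d - z) / r}"
    then have "x < R" "z + (r * x - d) \<noteq> a"
      using r by (auto simp: field_simps)
    define y where "y = z + (r * x - d)"
    have y: "y < b" "y \<noteq> a" "z - a + r * x - d = y - a"
      using r \<open>x < R\<close> \<open>z + (r * x - d) \<noteq> a\<close> by (simp_all add: y_def R_def field_simps)
    have tilt: "exp (\<kappa> * (d - r * x)) * exp (\<kappa> * (y - b)) = exp (\<kappa> * (z - b))"
      by (simp add: y_def mult_exp_exp algebra_simps)
    have "g x * h y = exp (\<kappa> * (z - b)) * (ph_density T \<nu> x * u (y - a))"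
    proof (cases "y < a")
      case False
      then have "g x * h y = (exp (\<kappa> * (d - r * x)) * exp (\<kappa> * (y - b))) * (ph_density T \<nu> x * u (y - a))"
        using y by (simp add: g_def h_def u_def)
      then show ?thesis
        by (simp only: tilt)
    qed (use \<open>y < b\<close> in \<open>simp add: h_def u_def\<close>)
    then show "g x * h (z + (r * x - d)) = exp (\<kappa> * (z - b)) * (ph_density T \<nu> x * u (z - a + r * x - d))"
      by (simp only: y y_def[symmetric])
  qed
  from has_integral_diff[OF this g_part]
  have in_part: "((\<lambda>x. g x * (h (z + (r * x - d)) - 1)) has_integral exp (\<kappa> * (z - b)) * u (z - a) - 1) {0..R}"
    by (simp add: algebra_simps)
  \<comment> \<open>Since \<open>g\<close> has mass 1, replacing \<open>h\<close> by \<open>h - 1\<close> removes the contribution beyond \<open>R\<close>.\<close>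
  have "((\<lambda>x. g x * (h (z + (r * x - d)) - 1)) has_integral exp (\<kappa> * (z - b)) * u (z - a) - 1) UNIV"
  proof (rule has_integral_on_superset[OF in_part])
    fix x assume "x \<notin> {0..R}"
    then have "x < 0 \<or> b \<le> z + (r * x - d)"
      using r by (auto simp: R_def field_simps)
    then show "g x * (h (z + (r * x - d)) - 1) = 0"
      by (auto simp: g_def h_def ph_density_def)
  qed simp
  moreover have gh_int: "integrable lborel (\<lambda>x. g x * h (z + (r * x - d)))"
  proof (rule Bochner_Integration.integrable_bound)
    show "integrable lborel (\<lambda>x. max 1 B * g x)"
      using g_int by simp
    show "(\<lambda>x. g x * h (z + (r * x - d))) \<in> borel_measurable lborel"
      using borel_measurable_integrable[OF g_int(1)] by measurable
    have "norm (g x * h (z + (r * x - d))) \<le> norm (max 1 B * g x)" for x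
      using mult_left_mono[OF h_bound[of "z + (r * x - d)"], of "\<bar>g x\<bar>"] by (simp add: abs_mult mult.commute)
    then show "AE x in lborel. norm (g x * h (z + (r * x - d))) \<le> norm (max 1 B * g x)" by simp
  qed
  then have "((\<lambda>x. g x * h (z + (r * x - d)) - g x) has_integral (LINT x|lborel. g x * h (z + (r * x - d))) - 1) UNIV"
    using has_integral_diff[OF has_integral_integral_lborel[OF gh_int] has_integral_integral_lborel[OF g_int(1)]] g_int(2) by simp
  ultimately have "exp (\<kappa> * (z - b)) * u (z - a) - 1 = (LINT x|lborel. g x * h (z + (r * x - d))) - 1"
    by (intro has_integral_unique[of _ _ UNIV]) (simp_all add: right_diff_distrib)
  then show "(LINT x|lborel. g x * h (z + (r * x - d))) = h z"
    using z by (simp add: h_def u_def)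
qed

text \<open>
  Almost surely all observations lie where the density is positive, so there the likelihood-ratio
  statistic coincides with the random walk \<open>X\<close>, to which the exit probabilities of the harmonic function \<open>h\<close> apply.
  The parameter \<open>\<kappa>\<close> is the degree of tilting of the true distribution of the observations.
\<close>

lemma wald_test_acceptance_probabilities:
  fixes T :: "real^'n^'n" and \<nu> p v :: "real^'n" and H :: "real \<Rightarrow> real^'n"
    and \<zeta> :: "nat \<Rightarrow> 'a \<Rightarrow> real"
  assumes ph: "phase_type T \<nu>" and r: "0 < r" and d: "0 < d" and sol: "delay_solution r d T (absorption_rates T) \<nu> p H"
    and ab: "a < 0" "0 < b" and H_end: "H (b + d - a) = v"
    and v: "(\<kappa> * r) *\<^sub>R v - T *v v = absorption_rates T"
    and mass: "exp (\<kappa> * d) * (\<nu> \<bullet> v) = 1"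
    and f_int: "integrable lborel (ph_density T \<nu>)" "(LINT x|lborel. ph_density T \<nu> x) = 1"
    and iid: "iid_density M \<zeta> (\<lambda>x. exp (\<kappa> * (d - r * x)) * ph_density T \<nu> x)"
    and lr: "\<And>x. 0 < ph_density T \<nu> x \<Longrightarrow> ln (f\<^sub>0 x / f\<^sub>1 x) = r * x - d"
    and f_meas: "f\<^sub>0 \<in> borel_measurable borel" "f\<^sub>1 \<in> borel_measurable borel"
  shows "prob_accept0 M f\<^sub>0 f\<^sub>1 \<zeta> a b = exp (- (\<kappa> * b)) * (\<nu> \<bullet> H (- a))"
    and "prob_accept1 M f\<^sub>0 f\<^sub>1 \<zeta> a b = 1 - exp (- (\<kappa> * b)) * (\<nu> \<bullet> H (- a))"
proof -
  note [measurable] = ph_density_measurable[OF ph] f_meas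
  define g where "g x = exp (\<kappa> * (d - r * x)) * ph_density T \<nu> x" for x
  have [measurable]: "g \<in> borel_measurable borel"
    unfolding g_def[abs_def] by measurable
  have g_nonneg: "0 \<le> g x" for x
    using ph_density_nonneg[OF ph] by (simp add: g_def)
  have g_pos_iff: "0 < g x \<longleftrightarrow> 0 < ph_density T \<nu> x" for x
    by (simp add: g_def zero_less_mult_iff)
  interpret prob_space M
    using iid by (simp add: iid_density_def)
  have indep: "indep_vars (\<lambda>_. borel) \<zeta> {1..}"
    using iid by (simp add: iid_density_def)
  have dist: "distributed M lborel (\<zeta> i) (\<lambda>x. ennreal (g x))" if "1 \<le> i" for i
    using iid that by (simp add: iid_density_def g_def[abs_def])
  have \<zeta>_meas [measurable]: "\<zeta> i \<in> borel_measurable M" if "1 \<le> i" for i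
    using distributed_measurable[OF dist[OF that]] by simp
  have g_int: "integrable lborel g" "(LINT x|lborel. g x) = 1"
    using distributed_density_integral[OF prob_space_axioms dist[of 1]] g_nonneg by simp_all

  define X where "X i \<omega> = r * \<zeta> i \<omega> - d" for i \<omega>
  define D where "D = distr (density lborel (\<lambda>x. ennreal (g x))) borel (\<lambda>x. r * x - d)"
  have X_indep: "indep_vars (\<lambda>_. borel) X {1..}"
    unfolding X_def by (rule indep_vars_compose2[OF indep]) simp
  have X_law: "distr M borel (X i) = D" if "1 \<le> i" for i
    unfolding D_def distributed_distr_eq_density[OF dist[OF that], symmetric]
    using that by (subst distr_distr) (auto simp: X_def[abs_def] o_def)

  define h where "h z = (if b \<le> z then 1 else if z \<le> a then 0 else exp (\<kappa> * (z - b)) * (\<nu> \<bullet> H (z - a)))" for z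
  have "a < b" using ab by simp
  note harm = scale_function_harmonic[OF ph r d sol \<open>a < b\<close> H_end v mass 
      g_int[unfolded g_def[abs_def]], folded g_def h_def]
  have h_eq: "(\<lambda>z. if b \<le> z then 1 else if z \<le> a then 0 else exp (\<kappa> * (z - b)) * (\<nu> \<bullet> H (z - a))) = h"
    by (simp add: h_def[abs_def])
  have h_meas [measurable]: "h \<in> borel_measurable borel"
    using harm(1) unfolding h_eq .
  have h_ends: "b \<le> z \<Longrightarrow> h z = 1" "z \<le> a \<Longrightarrow> h z = 0" for z
    using \<open>a < b\<close> by (simp_all add: h_def)
  obtain B where B: "\<And>z. \<bar>h z\<bar> \<le> B"
    using harm(2) by blast
  have harmonic: "(\<integral>x. h (z + x) \<partial>D) = h z" if "a < z" "z < b" for z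
  proof -
    have "(\<integral>x. h (z + x) \<partial>D) = (LINT x|lborel. g x * h (z + (r * x - d)))"
      unfolding D_def using g_nonneg by (simp add: integral_distr integral_density)
    also have "\<dots> = h z"
      by (rule harm(3)[OF that])
    finally show ?thesis .
  qed
  have big_step: "0 < measure D {b - a..}"
  proof (rule ccontr)
    interpret D: prob_space D
      using X_law[of 1] prob_space_distr[of "X 1" borel] by (simp add: X_def[abs_def])
    assume "\<not> 0 < measure D {b - a..}"
    then have "emeasure D {b - a..} = 0"
      by (simp add: D.emeasure_eq_measure zero_less_measure_iff)
    also have "emeasure D {b - a..} = (\<integral>\<^sup>+x. ennreal (g x) * indicator {(b - a + d) / r..} x \<partial>lborel)"
    proof -
      have "(\<lambda>x. r * x - d) -` {b - a..} = {(b - a + d) / r..}"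
        using r by (auto simp: field_simps)
      then show ?thesis
        unfolding D_def by (simp add: emeasure_distr emeasure_density)
    qed
    finally have "AE x in lborel. ennreal (g x) * indicator {(b - a + d) / r..} x = 0"
      by (subst (asm) nn_integral_0_iff_AE) auto
    then have "AE x in lborel. (b - a + d) / r \<le> x \<longrightarrow> ph_density T \<nu> x = 0"
    proof eventually_elim
      case (elim x)
      then show ?case
        using g_nonneg[of x] g_pos_iff[of x] ph_density_nonneg[OF ph, of x] 
        by (auto simp: indicator_def ennreal_eq_0_iff split: if_splits)
    qed
    then show False
      using ph_density_tail_pos[OF ph f_int] by blast
  qed

  have ae_lr: "AE \<omega> in M. \<forall>k. log_lr f\<^sub>0 f\<^sub>1 \<zeta> k \<omega> = (\<Sum>i=1..k. X i \<omega>)"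
  proof -
    have "AE \<omega> in M. 1 \<le> i \<longrightarrow> ln (f\<^sub>0 (\<zeta> i \<omega>) / f\<^sub>1 (\<zeta> i \<omega>)) = X i \<omega>" for i
    proof (cases "1 \<le> i")
      case True
      have "AE \<omega> in M. 0 < g (\<zeta> i \<omega>)"
        by (subst distributed_AE2[OF dist[OF True]]) auto
      then show ?thesis
        by eventually_elim (simp add: g_pos_iff lr X_def)
    qed simp
    then have "AE \<omega> in M. \<forall>i. 1 \<le> i \<longrightarrow> ln (f\<^sub>0 (\<zeta> i \<omega>) / f\<^sub>1 (\<zeta> i \<omega>)) = X i \<omega>"
      by (simp add: AE_all_countable)
    then show ?thesis
      by eventually_elim (auto simp: log_lr_def intro!: sum.cong)
  qed
  have [measurable]: "(\<lambda>\<omega>. log_lr f\<^sub>0 f\<^sub>1 \<zeta> k \<omega>) \<in> borel_measurable M" for k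
    unfolding log_lr_def by (intro borel_measurable_sum) (auto intro: measurable_compose)
  have [measurable]: "(\<lambda>\<omega>. stopped_walk a b (\<lambda>i. X i \<omega>) k) \<in> borel_measurable M" for k
  proof -
    have "(\<lambda>\<omega>. \<lambda>i\<in>{1..}. X i \<omega>) \<in> measurable M (PiM {1..} (\<lambda>_. borel))"
      by (intro measurable_restrict) (auto simp: X_def)
    from measurable_compose[OF this measurable_stopped_walk[of k]]
    have "(\<lambda>\<omega>. stopped_walk a b (\<lambda>i\<in>{1..}. X i \<omega>) k) \<in> borel_measurable M"
      by auto
    also have "(\<lambda>\<omega>. stopped_walk a b (\<lambda>i\<in>{1..}. X i \<omega>) k) = (\<lambda>\<omega>. stopped_walk a b (\<lambda>i. X i \<omega>) k)"
      by (auto intro!: ext stopped_walk_cong)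
    finally show ?thesis .
  qed
  have transfer: "prob {\<omega> \<in> space M. \<exists>k. exit_index a b (log_lr f\<^sub>0 f\<^sub>1 \<zeta>) \<omega> = enat k \<and> log_lr f\<^sub>0 f\<^sub>1 \<zeta> k \<omega> \<in> C} =
      prob {\<omega> \<in> space M. \<exists>k. stopped_walk a b (\<lambda>i. X i \<omega>) k \<in> C}"
    if [measurable]: "C \<in> sets borel" and "C \<inter> {a<..<b} = {}" for C
  proof (rule finite_measure_eq_AE)
    show "AE \<omega> in M. (\<omega> \<in> {\<omega> \<in> space M. \<exists>k. exit_index a b (log_lr f\<^sub>0 f\<^sub>1 \<zeta>) \<omega> = enat k \<and> log_lr f\<^sub>0 f\<^sub>1 \<zeta> k \<omega> \<in> C}) \<longleftrightarrow>
        (\<omega> \<in> {\<omega> \<in> space M. \<exists>k. stopped_walk a b (\<lambda>i. X i \<omega>) k \<in> C})"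
      using ae_lr
    proof eventually_elim
      case (elim \<omega>)
      then show ?case
        using exit_iff_stopped_walk[of "log_lr f\<^sub>0 f\<^sub>1 \<zeta>" \<omega> "\<lambda>i. X i \<omega>" C a b] that(2) by simp
    qed
    show "{\<omega> \<in> space M. \<exists>k. exit_index a b (log_lr f\<^sub>0 f\<^sub>1 \<zeta>) \<omega> = enat k \<and> log_lr f\<^sub>0 f\<^sub>1 \<zeta> k \<omega> \<in> C} \<in> events"
      unfolding exit_index_eq_enat_iff by measurable
    show "{\<omega> \<in> space M. \<exists>k. stopped_walk a b (\<lambda>i. X i \<omega>) k \<in> C} \<in> events"
      by measurable
  qed
  have h_0: "h 0 = exp (- (\<kappa> * b)) * (\<nu> \<bullet> H (- a))"
    using ab by (simp add: h_def)
  have disj: "{b..} \<inter> {a<..<b} = {}" "{..a} \<inter> {a<..<b} = {}"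
    by auto
  note walk = random_walk_exit_probability[OF X_indep X_law ab h_meas B h_ends harmonic big_step]
  have "prob_accept0 M f\<^sub>0 f\<^sub>1 \<zeta> a b = h 0"
    using transfer[OF _ disj(1)] walk(1) by (simp add: prob_accept0_def)
  then show "prob_accept0 M f\<^sub>0 f\<^sub>1 \<zeta> a b = exp (- (\<kappa> * b)) * (\<nu> \<bullet> H (- a))"
    by (simp only: h_0)
  have "prob_accept1 M f\<^sub>0 f\<^sub>1 \<zeta> a b = 1 - h 0"
    using transfer[OF _ disj(2)] walk(2) by (simp add: prob_accept1_def)
  then show "prob_accept1 M f\<^sub>0 f\<^sub>1 \<zeta> a b = 1 - exp (- (\<kappa> * b)) * (\<nu> \<bullet> H (- a))"
    by (simp only: h_0)
qed

theorem theorem1: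
  fixes T\<^sub>0 :: "real^'n^'n" and \<nu>\<^sub>0 t\<^sub>0 :: "real^'n"
    and f\<^sub>0 f\<^sub>1 :: "real \<Rightarrow> real"
    and \<theta> d a b \<alpha>\<^sub>0 \<alpha>\<^sub>1 :: real
    and M\<^sub>0 M\<^sub>1 :: "'a measure" and \<zeta> :: "nat \<Rightarrow> 'a \<Rightarrow> real"
    and W\<^sub>0 :: "real \<Rightarrow> real^'n^'n"
  assumes ph: "phase_type T\<^sub>0 \<nu>\<^sub>0"
    and t0: "t\<^sub>0 = absorption_rates T\<^sub>0"
    and f0: "f\<^sub>0 = ph_density T\<^sub>0 \<nu>\<^sub>0"
    and theta: "\<theta> > 0"
    and f1: "f\<^sub>1 = tilted_density f\<^sub>0 \<theta>"
    and d: "d = - ln (laplace f\<^sub>0 \<theta>)"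
    and ab: "a < 0" "0 < b"
    and space: "sets M\<^sub>1 = sets M\<^sub>0"
    and H0: "iid_density M\<^sub>0 \<zeta> f\<^sub>0"
    and H1: "iid_density M\<^sub>1 \<zeta> f\<^sub>1"
    and alpha0: "\<alpha>\<^sub>0 = prob_accept1 M\<^sub>0 f\<^sub>0 f\<^sub>1 \<zeta> a b"
    and alpha1: "\<alpha>\<^sub>1 = prob_accept0 M\<^sub>1 f\<^sub>0 f\<^sub>1 \<zeta> a b"
    and W_cont: "continuous_on {0..} W\<^sub>0"
    and W_transform: "\<forall>\<^sub>F s in at_top.
       set_integrable lborel {0..} (\<lambda>x. exp (- (s * x)) *\<^sub>R W\<^sub>0 x) \<and>
       (LINT x:{0..}|lborel. exp (- (s * x)) *\<^sub>R W\<^sub>0 x) =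
         matrix_inv (T\<^sub>0 + (\<theta> * s) *\<^sub>R mat 1 + exp (- (d * s)) *\<^sub>R outer t\<^sub>0 \<nu>\<^sub>0)"
  shows "d > 0
    \<and> invertible (W\<^sub>0 (- a + b + d))
    \<and> \<alpha>\<^sub>0 = 1 - \<nu>\<^sub>0 \<bullet> ((W\<^sub>0 (- a) ** matrix_inv (W\<^sub>0 (- a + b + d))) *v 1)
    \<and> \<alpha>\<^sub>1 = exp (- b) *
        (\<nu>\<^sub>0 \<bullet> ((W\<^sub>0 (- a) ** matrix_inv (W\<^sub>0 (- a + b + d)) ** matrix_inv (\<theta> *\<^sub>R mat 1 - T\<^sub>0)) *v t\<^sub>0))"
proof -
  define G where "G = laplace f\<^sub>0 \<theta>"
  note [measurable] = ph_density_measurable[OF ph, folded f0]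
  have f0_nonneg: "0 \<le> f\<^sub>0 x" for x
    unfolding f0 by (rule ph_density_nonneg[OF ph])
  have f0_zero: "f\<^sub>0 x = 0" if "x \<le> 0" for x
    using that by (simp add: f0 ph_density_def)
  have f0_int: "integrable lborel f\<^sub>0" "(LINT x|lborel. f\<^sub>0 x) = 1"
    using H0 distributed_density_integral[of M\<^sub>0 "\<zeta> 1" f\<^sub>0] f0_nonneg by (auto simp: iid_density_def)
  have G: "0 < G" "G < 1"
    unfolding G_def using laplace_between_0_1[OF f0_int f0_nonneg _ theta] f0_zero by auto
  then have d_pos: "0 < d"
    by (simp add: d G_def)
  have exp_d: "exp d = 1 / G"
    using G by (simp add: d G_def exp_minus divide_inverse)
  have f1_eq: "f\<^sub>1 x = exp (d - \<theta> * x) * f\<^sub>0 x" for x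
    by (simp add: f1 tilted_density_def exp_diff exp_minus exp_d G_def[symmetric] divide_inverse)
  have [measurable]: "f\<^sub>1 \<in> borel_measurable borel"
    unfolding f1_eq[abs_def] by measurable
  have lr: "ln (f\<^sub>0 x / f\<^sub>1 x) = \<theta> * x - d" if "0 < ph_density T\<^sub>0 \<nu>\<^sub>0 x" for x
    using that by (simp add: f1_eq f0[symmetric] ln_div)

  define L where "L = - a + b + d"
  have "0 \<le> L"
    using ab d_pos by (simp add: L_def)
  have sol: "delay_solution \<theta> d T\<^sub>0 (absorption_rates T\<^sub>0) \<nu>\<^sub>0 q (\<lambda>x. W\<^sub>0 x *v q)" for q
    using scale_function_delay_solution[OF theta d_pos W_cont W_transform] by (simp add: t0)
  have W_inv: "invertible (W\<^sub>0 L)"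
  proof -
    have "p = 0" if "W\<^sub>0 L *v p = 0" for p
      by (rule delay_solution_zero_at_end[OF ph theta d_pos sol \<open>0 \<le> L\<close> that])
    then show ?thesis
      using matrix_left_invertible_ker by (subst invertible_left_inverse) blast
  qed
  have W_end: "W\<^sub>0 (b + d - a) *v (matrix_inv (W\<^sub>0 L) *v v) = v" for v
  proof -
    have "b + d - a = L" by (simp add: L_def)
    then show ?thesis
      using matrix_inv_right[OF W_inv] by (simp add: matrix_vector_mul_assoc)
  qed

  \<comment> \<open>Under the untilted law (\<open>\<kappa> = 0\<close>) the boundary value is \<open>v = 1\<close>, since \<open>- T 1 = t\<close>.\<close>
  have "\<alpha>\<^sub>0 = 1 - exp (- (0 * b)) * (\<nu>\<^sub>0 \<bullet> (W\<^sub>0 (- a) *v (matrix_inv (W\<^sub>0 L) *v 1)))"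
    unfolding alpha0
  proof (rule wald_test_acceptance_probabilities(2)[OF ph theta d_pos sol ab W_end])
    show "(0 * \<theta>) *\<^sub>R 1 - T\<^sub>0 *v 1 = absorption_rates T\<^sub>0"
      by (simp add: absorption_rates_def)
    show "exp (0 * d) * (\<nu>\<^sub>0 \<bullet> 1) = 1"
      using ph_initial(2)[OF ph] by (simp add: inner_vec_def)
    show "iid_density M\<^sub>0 \<zeta> (\<lambda>x. exp (0 * (d - \<theta> * x)) * ph_density T\<^sub>0 \<nu>\<^sub>0 x)"
      using H0 by (simp add: f0)
  qed (use f0_int lr in \<open>auto simp: f0[symmetric]\<close>)
  then have \<alpha>0: "\<alpha>\<^sub>0 = 1 - \<nu>\<^sub>0 \<bullet> ((W\<^sub>0 (- a) ** matrix_inv (W\<^sub>0 L)) *v 1)"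
    by (simp add: matrix_vector_mul_assoc)

  define v where "v = matrix_inv (\<theta> *\<^sub>R mat 1 - T\<^sub>0) *v t\<^sub>0"
  have v: "\<theta> *\<^sub>R v - T\<^sub>0 *v v = t\<^sub>0"
  proof -
    have "invertible (\<theta> *\<^sub>R mat 1 - T\<^sub>0)"
      using ph_offdiag_nonneg[OF ph] ph_row_sum_nonpos[OF ph] theta by (rule invertible_resolvent)
    then have "(\<theta> *\<^sub>R mat 1 - T\<^sub>0) *v v = t\<^sub>0"
      by (simp add: v_def matrix_vector_mul_assoc matrix_inv_right)
    then show ?thesis
      by (simp add: matrix_vector_mult_diff_rdistrib flip: scaleR_matrix_vector_assoc)
  qed
  \<comment> \<open>This is the mass condition \<open>exp d (\<nu> \<bullet> v) = 1\<close> of the tilted law, as \<open>exp d = 1 / G\<close>.\<close>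
  have G_eq: "G = \<nu>\<^sub>0 \<bullet> v"
    unfolding G_def f0 using f0_int(1) theta v
    by (intro laplace_ph_density[OF ph]) (simp_all add: f0 t0)
  have "\<alpha>\<^sub>1 = exp (- (1 * b)) * (\<nu>\<^sub>0 \<bullet> (W\<^sub>0 (- a) *v (matrix_inv (W\<^sub>0 L) *v v)))"
    unfolding alpha1
  proof (rule wald_test_acceptance_probabilities(1)[OF ph theta d_pos sol ab W_end])
    show "(1 * \<theta>) *\<^sub>R v - T\<^sub>0 *v v = absorption_rates T\<^sub>0"
      using v by (simp add: t0)
    show "exp (1 * d) * (\<nu>\<^sub>0 \<bullet> v) = 1"
      using G by (simp add: exp_d flip: G_eq)
    show "iid_density M\<^sub>1 \<zeta> (\<lambda>x. exp (1 * (d - \<theta> * x)) * ph_density T\<^sub>0 \<nu>\<^sub>0 x)"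
      using H1 by (simp add: f1_eq[abs_def] f0)
  qed (use f0_int lr in \<open>auto simp: f0[symmetric]\<close>)
  then have \<alpha>1: "\<alpha>\<^sub>1 = exp (- b) *
      (\<nu>\<^sub>0 \<bullet> ((W\<^sub>0 (- a) ** matrix_inv (W\<^sub>0 L) ** matrix_inv (\<theta> *\<^sub>R mat 1 - T\<^sub>0)) *v t\<^sub>0))"
    by (simp add: matrix_vector_mul_assoc matrix_mul_assoc v_def)
  show ?thesis
    using d_pos W_inv \<alpha>0 \<alpha>1 unfolding L_def by blast
qed

end
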